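(* Let $(\mathcal{C},\mathcal{D})$ be one of the pairs $(\mathbf{MFrm},\mathbf{RelSp})$, $(\mathbf{MFrm},\mathbf{RelSpq})$, $(\mathbf{CMFrm}^{\Box\Diamond},\mathbf{RelSpq}^{c})$, $(\mathbf{CEqFrm},\mathbf{EqSpq})$, and let $\mathcal{F}$ be the corresponding version of the point construction. If $A$ is an object of $\mathcal{C}$ that is modally spectral, then $\phi_A:A\to\Omega(\mathcal{F}(A))$ is an isomorphism of $\mathcal{C}$.
   Context: Relational spaces. A relational space $(X,\mathcal{O},R)$ is a topological space $(X,\mathcal{O})$ with an arbitrary binary relation $R\subseteq X\times X$. Write $R^{\rightarrow}(x)=\{x'\mid xRx'\}$. For $U\subseteq X$ put $\Box_R U=\{x\mid R^{\rightarrow}(x)\subseteq U\}$, $\Diamond_R U=\{x\mid R^{\rightarrow}(x)\cap U\neq\emptyset\}$. The space is continuous if $\Box_R U$ and $\Diamond_R U$ are open for all open $U$; it is an equivalence space if it is continuous and $R$ is an equivalence relation. $\Omega(X,\mathcal{O},R)=(\mathcal{O},\Box,\Diamond)$ is the frame of opens with $\Box U$, $\Diamond U$ the interiors of $\Box_R U$, $\Diamond_R U$. $\mathbf{RelSp}$ and $\mathbf{RelSpq}$ are categories of all relational spaces (the former with continuous p-morphisms, the latter with continuous pq-morphisms), $\mathbf{RelSpq}^c$ of continuous relational spaces, $\mathbf{EqSpq}$ of equivalence spaces; here they only serve to name the versions of the point construction below. Modal frames. A modal frame $(A,\Box,\Diamond)$ is a frame $A$ with monotone maps $\Box,\Diamond:A\to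 A$ such that for all $a,b$: $\top\le\Box\top$; $\Box a\wedge\Box b\le\Box(a\wedge b)$; $\Box a\wedge\Diamond b\le\Diamond(a\wedge b)$; $\Diamond\bot\le\bot$. It is convex if for all $a,b$: $\Diamond(a\vee b)\le\Diamond a\vee\Diamond b$ and $\Box(a\vee b)\le\Box a\vee\Diamond b$. It is an equivalence frame if for all $a$: $\Box a\le a$, $a\le\Diamond a$, $\Box a\le\Box\Box a$, $\Diamond\Diamond a\le\Diamond a$, $\Diamond\Box a\le a$, $a\le\Box\Diamond a$. A modal frame morphism is a frame morphism $f$ with $f(\Box a)\le\Box f(a)$ and $f(\Diamond a)\le\Diamond f(a)$ for all $a$; it is strict if both are always equalities. $\mathbf{MFrm}$: modal frames and modal frame morphisms; $\mathbf{CMFrm}^{\Box\Diamond}$: convex modal frames and strict morphisms; $\mathbf{CEqFrm}$: convex equivalence frames and strict morphisms. An element $a$ of a frame is compact if $a\le\bigvee S$ with $S$ directed implies $a\le s$ for some $s\in S$. A frame is spectral if finite meets of compact elements (including $\top$) are compact and every element is a join of compact elements. A modal frame is modally spectral if it is spectral as a frame and both $\Box$ and $\Diamond$ preserve directed joins and map compact elements to compact elements. Point construction. A frame character is a frame morphism $p:A\to\mathbf 2=\{0<1\}$; $\nabla(p)=\{a\mid p(a)=1\}$; $F_p=\{c\mid p(\Box c)=1\}$. Filters are nonempty up-closed subsets closed under binary meets (possibly all of $A$). Consider, for a frame character $p$, $a\in A$ and a filter $F\subseteq A$: (i) $p(\Diamond a)=0$; (ii) for all $c$, $p(\Diamond c)=0$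 implies $c\le a$; (iii) $F_p\subseteq F$; (iv) $F\subseteq F_p$. Pre-points are: for $\mathbf{RelSp}$, pairs $(p,a)$ with (i); for $\mathbf{RelSpq}$, triples $(p,a,F)$ with (i),(iii); for $\mathbf{RelSpq}^c$ and $\mathbf{EqSpq}$, triples $(p,a,F)$ with (i)–(iv). Relation on pre-points: $(p,a)R_A(q,b)$ iff $q(a)=0$ and $p(\Box c)\le q(c)$ for all $c$; $(p,a,F)R_A(q,b,G)$ iff $q(a)=0$ and $F\subseteq\nabla(q)$. The set $\mathbb{P}_A$ of points is the largest set of pre-points such that: (D) for each point with first components $p,a$ and each $c\not\le a$ there is an $R_A$-related point with first component $q$ such that $q(c)=1$; and, in the triple versions only, also (B) for each point $(p,a,F)$ and each $c\notin F$ there is an $R_A$-related point with first component $q$ such that $q(c)=0$. Let $\phi_A(c)$ be the set of points whose first component $p$ has $p(c)=1$; the topology $\mathfrak{O}_A$ on $\mathbb{P}_A$ is $\{\phi_A(c)\mid c\in A\}$, and $\mathcal{F}(A)=(\mathbb{P}_A,\mathfrak{O}_A,R_A)$. *)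

theory Defs
  imports "HOL-Algebra.Complete_Lattice" "HOL-Analysis.Abstract_Topology"
begin

section \<open>Frames and modal frames\<close>

locale frame = complete_lattice +
  assumes meet_sup_distrib:
    "\<lbrakk>x \<in> carrier L; S \<subseteq> carrier L\<rbrakk> \<Longrightarrow> x \<sqinter> (\<Squnion>S) = \<Squnion>((\<lambda>s. x \<sqinter> s) ` S)"

text \<open>Finitary meets are preserved via \<^const>\<open>meet_pres\<close> and the top element; \<^const>\<open>sup_pres\<close>
  includes the empty join.\<close>

definition frame_hom ::
    "('a, 'm) gorder_scheme \<Rightarrow> ('b, 'n) gorder_scheme \<Rightarrow> ('a \<Rightarrow> 'b) \<Rightarrow> bool" where
  "frame_hom A B f \<longleftrightarrow>
     frame A \<and> frame B \<and> f \<in> carrier A \<rightarrow> carrier B \<and>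
     sup_pres A B f \<and> meet_pres A B f \<and> f \<top>\<^bsub>A\<^esub> = \<top>\<^bsub>B\<^esub>"

record 'a modal_order = "'a gorder" +
  mbox :: "'a \<Rightarrow> 'a"  (\<open>\<box>\<index>_\<close> [90] 90)
  mdia :: "'a \<Rightarrow> 'a"  (\<open>\<diamond>\<index>_\<close> [90] 90)

locale modal_frame = frame A for A :: "('a, 'm) modal_order_scheme" (structure) +
  assumes mbox_closed: "mbox A \<in> carrier A \<rightarrow> carrier A"
    and mdia_closed: "mdia A \<in> carrier A \<rightarrow> carrier A"
    and mbox_mono: "isotone A A (mbox A)"
    and mdia_mono: "isotone A A (mdia A)"
    and mbox_top: "\<top> \<sqsubseteq> \<box>\<top>"
    and mbox_meet: "\<lbrakk>a \<in> carrier A; b \<in> carrier A\<rbrakk> \<Longrightarrow> \<box>a \<sqinter> \<box>b \<sqsubseteq> \<box>(a \<sqinter> b)"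
    and mbox_mdia_meet: "\<lbrakk>a \<in> carrier A; b \<in> carrier A\<rbrakk> \<Longrightarrow> \<box>a \<sqinter> \<diamond>b \<sqsubseteq> \<diamond>(a \<sqinter> b)"
    and mdia_bottom: "\<diamond>\<bottom> \<sqsubseteq> \<bottom>"

locale convex_modal_frame = modal_frame +
  assumes mdia_join: "\<lbrakk>a \<in> carrier A; b \<in> carrier A\<rbrakk> \<Longrightarrow> \<diamond>(a \<squnion> b) \<sqsubseteq> \<diamond>a \<squnion> \<diamond>b"
    and mbox_join: "\<lbrakk>a \<in> carrier A; b \<in> carrier A\<rbrakk> \<Longrightarrow> \<box>(a \<squnion> b) \<sqsubseteq> \<box>a \<squnion> \<diamond>b"

locale equivalence_frame = modal_frame +
  assumes mbox_le: "a \<in> carrier A \<Longrightarrow> \<box>a \<sqsubseteq> a"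
    and le_mdia: "a \<in> carrier A \<Longrightarrow> a \<sqsubseteq> \<diamond>a"
    and mbox_trans: "a \<in> carrier A \<Longrightarrow> \<box>a \<sqsubseteq> \<box>(\<box>a)"
    and mdia_trans: "a \<in> carrier A \<Longrightarrow> \<diamond>(\<diamond>a) \<sqsubseteq> \<diamond>a"
    and mdia_mbox_le: "a \<in> carrier A \<Longrightarrow> \<diamond>(\<box>a) \<sqsubseteq> a"
    and le_mbox_mdia: "a \<in> carrier A \<Longrightarrow> a \<sqsubseteq> \<box>(\<diamond>a)"

locale convex_equivalence_frame = convex_modal_frame + equivalence_frame


section \<open>The categories of modal frames\<close>

text \<open>The arrow predicates require source and target to be objects of the category. An arrow is
  determined by its values on the carrier of its source, so inverses are only compared there.\<close>

definition MFrm_hom ::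
    "('a, 'm) modal_order_scheme \<Rightarrow> ('b, 'n) modal_order_scheme \<Rightarrow> ('a \<Rightarrow> 'b) \<Rightarrow> bool" where
  "MFrm_hom A B f \<longleftrightarrow>
     modal_frame A \<and> modal_frame B \<and> frame_hom A B f \<and>
     (\<forall>a\<in>carrier A. f (\<box>\<^bsub>A\<^esub>a) \<sqsubseteq>\<^bsub>B\<^esub> \<box>\<^bsub>B\<^esub>(f a)) \<and>
     (\<forall>a\<in>carrier A. f (\<diamond>\<^bsub>A\<^esub>a) \<sqsubseteq>\<^bsub>B\<^esub> \<diamond>\<^bsub>B\<^esub>(f a))"

definition strict_MFrm_hom ::
    "('a, 'm) modal_order_scheme \<Rightarrow> ('b, 'n) modal_order_scheme \<Rightarrow> ('a \<Rightarrow> 'b) \<Rightarrow> bool" where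
  "strict_MFrm_hom A B f \<longleftrightarrow>
     MFrm_hom A B f \<and>
     (\<forall>a\<in>carrier A. f (\<box>\<^bsub>A\<^esub>a) = \<box>\<^bsub>B\<^esub>(f a)) \<and>
     (\<forall>a\<in>carrier A. f (\<diamond>\<^bsub>A\<^esub>a) = \<diamond>\<^bsub>B\<^esub>(f a))"

definition CMFrm_hom ::
    "('a, 'm) modal_order_scheme \<Rightarrow> ('b, 'n) modal_order_scheme \<Rightarrow> ('a \<Rightarrow> 'b) \<Rightarrow> bool" where
  "CMFrm_hom A B f \<longleftrightarrow>
     convex_modal_frame A \<and> convex_modal_frame B \<and> strict_MFrm_hom A B f"

definition CEqFrm_hom ::
    "('a, 'm) modal_order_scheme \<Rightarrow> ('b, 'n) modal_order_scheme \<Rightarrow> ('a \<Rightarrow> 'b) \<Rightarrow> bool" where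
  "CEqFrm_hom A B f \<longleftrightarrow>
     convex_equivalence_frame A \<and> convex_equivalence_frame B \<and> strict_MFrm_hom A B f"

definition mutually_inverse ::
    "('a, 'm) modal_order_scheme \<Rightarrow> ('b, 'n) modal_order_scheme \<Rightarrow> ('a \<Rightarrow> 'b) \<Rightarrow> ('b \<Rightarrow> 'a) \<Rightarrow> bool"
  where
  "mutually_inverse A B f g \<longleftrightarrow>
     (\<forall>a\<in>carrier A. g (f a) = a) \<and> (\<forall>b\<in>carrier B. f (g b) = b)"

definition MFrm_iso ::
    "('a, 'm) modal_order_scheme \<Rightarrow> ('b, 'n) modal_order_scheme \<Rightarrow> ('a \<Rightarrow> 'b) \<Rightarrow> bool" where
  "MFrm_iso A B f \<longleftrightarrow> MFrm_hom A B f \<and> (\<exists>g. MFrm_hom B A g \<and> mutually_inverse A B f g)"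

definition CMFrm_iso ::
    "('a, 'm) modal_order_scheme \<Rightarrow> ('b, 'n) modal_order_scheme \<Rightarrow> ('a \<Rightarrow> 'b) \<Rightarrow> bool" where
  "CMFrm_iso A B f \<longleftrightarrow> CMFrm_hom A B f \<and> (\<exists>g. CMFrm_hom B A g \<and> mutually_inverse A B f g)"

definition CEqFrm_iso ::
    "('a, 'm) modal_order_scheme \<Rightarrow> ('b, 'n) modal_order_scheme \<Rightarrow> ('a \<Rightarrow> 'b) \<Rightarrow> bool" where
  "CEqFrm_iso A B f \<longleftrightarrow> CEqFrm_hom A B f \<and> (\<exists>g. CEqFrm_hom B A g \<and> mutually_inverse A B f g)"


section \<open>Modally spectral frames\<close>

text \<open>Directed sets are nonempty.\<close>

definition directed :: "('a, 'm) gorder_scheme \<Rightarrow> 'a set \<Rightarrow> bool" where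
  "directed A S \<longleftrightarrow>
     S \<subseteq> carrier A \<and> S \<noteq> {} \<and> (\<forall>x\<in>S. \<forall>y\<in>S. \<exists>z\<in>S. x \<sqsubseteq>\<^bsub>A\<^esub> z \<and> y \<sqsubseteq>\<^bsub>A\<^esub> z)"

definition compact_elements :: "('a, 'm) gorder_scheme \<Rightarrow> 'a set" where
  "compact_elements A =
     {a \<in> carrier A. \<forall>S. directed A S \<and> a \<sqsubseteq>\<^bsub>A\<^esub> \<Squnion>\<^bsub>A\<^esub>S \<longrightarrow> (\<exists>s\<in>S. a \<sqsubseteq>\<^bsub>A\<^esub> s)}"

locale spectral_frame = frame A for A (structure) +
  assumes top_compact: "\<top> \<in> compact_elements A"
    and meet_compact:
      "\<lbrakk>a \<in> compact_elements A; b \<in> compact_elements A\<rbrakk> \<Longrightarrow> a \<sqinter> b \<in> compact_elements A"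
    and join_of_compacts: "a \<in> carrier A \<Longrightarrow> \<exists>S \<subseteq> compact_elements A. a = \<Squnion>S"

locale modally_spectral_frame =
  modal_frame A + spectral_frame A for A :: "('a, 'm) modal_order_scheme" (structure) +
  assumes mbox_directed: "directed A S \<Longrightarrow> \<box>(\<Squnion>S) = \<Squnion>(mbox A ` S)"
    and mdia_directed: "directed A S \<Longrightarrow> \<diamond>(\<Squnion>S) = \<Squnion>(mdia A ` S)"
    and mbox_compact: "a \<in> compact_elements A \<Longrightarrow> \<box>a \<in> compact_elements A"
    and mdia_compact: "a \<in> compact_elements A \<Longrightarrow> \<diamond>a \<in> compact_elements A"


section \<open>Relational spaces\<close>

record 'x rel_space =
  space_topology :: "'x topology"
  space_rel :: "('x \<times> 'x) set"

definition relational_space :: "'x rel_space \<Rightarrow> bool" where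
  "relational_space X \<longleftrightarrow>
     space_rel X \<subseteq> topspace (space_topology X) \<times> topspace (space_topology X)"

definition rel_box :: "'x rel_space \<Rightarrow> 'x set \<Rightarrow> 'x set" where
  "rel_box X U = {x \<in> topspace (space_topology X). space_rel X `` {x} \<subseteq> U}"

definition rel_dia :: "'x rel_space \<Rightarrow> 'x set \<Rightarrow> 'x set" where
  "rel_dia X U = {x \<in> topspace (space_topology X). space_rel X `` {x} \<inter> U \<noteq> {}}"

definition Omega :: "'x rel_space \<Rightarrow> 'x set modal_order" where
  "Omega X =
     \<lparr>carrier = {U. openin (space_topology X) U}, eq = (=), le = (\<subseteq>),
      mbox = (\<lambda>U. space_topology X interior_of rel_box X U),
      mdia = (\<lambda>U. space_topology X interior_of rel_dia X U)\<rparr>"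


section \<open>Points of modal frames\<close>

definition two :: "bool gorder" where
  "two = \<lparr>carrier = UNIV, eq = (=), le = (\<le>)\<rparr>"

text \<open>Requiring \<^const>\<open>extensional\<close> makes equality of HOL functions coincide with equality of
  maps on the carrier.\<close>

definition frame_character :: "('a, 'm) gorder_scheme \<Rightarrow> ('a \<Rightarrow> bool) \<Rightarrow> bool" where
  "frame_character A p \<longleftrightarrow> frame_hom A two p \<and> p \<in> extensional (carrier A)"

definition char_nabla :: "('a, 'm) gorder_scheme \<Rightarrow> ('a \<Rightarrow> bool) \<Rightarrow> 'a set" where
  "char_nabla A p = {a \<in> carrier A. p a}"

definition char_filter :: "('a, 'm) modal_order_scheme \<Rightarrow> ('a \<Rightarrow> bool) \<Rightarrow> 'a set" where
  "char_filter A p = {c \<in> carrier A. p (\<box>\<^bsub>A\<^esub>c)}"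

definition lattice_filter :: "('a, 'm) gorder_scheme \<Rightarrow> 'a set \<Rightarrow> bool" where
  "lattice_filter A F \<longleftrightarrow>
     F \<subseteq> carrier A \<and> F \<noteq> {} \<and>
     (\<forall>x\<in>F. \<forall>y\<in>carrier A. x \<sqsubseteq>\<^bsub>A\<^esub> y \<longrightarrow> y \<in> F) \<and>
     (\<forall>x\<in>F. \<forall>y\<in>F. x \<sqinter>\<^bsub>A\<^esub> y \<in> F)"

type_synonym 'a point2 = "('a \<Rightarrow> bool) \<times> 'a"
type_synonym 'a point3 = "('a \<Rightarrow> bool) \<times> 'a \<times> 'a set"

definition pre_points_RelSp :: "('a, 'm) modal_order_scheme \<Rightarrow> 'a point2 set" where
  "pre_points_RelSp A =
     {(p, a). frame_character A p \<and> a \<in> carrier A \<and> \<not> p (\<diamond>\<^bsub>A\<^esub>a)}"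

definition pre_points_RelSpq :: "('a, 'm) modal_order_scheme \<Rightarrow> 'a point3 set" where
  "pre_points_RelSpq A =
     {(p, a, F). frame_character A p \<and> a \<in> carrier A \<and> lattice_filter A F \<and>
        \<not> p (\<diamond>\<^bsub>A\<^esub>a) \<and> char_filter A p \<subseteq> F}"

definition pre_points_RelSpqc :: "('a, 'm) modal_order_scheme \<Rightarrow> 'a point3 set" where
  "pre_points_RelSpqc A =
     {(p, a, F). frame_character A p \<and> a \<in> carrier A \<and> lattice_filter A F \<and>
        \<not> p (\<diamond>\<^bsub>A\<^esub>a) \<and> (\<forall>c\<in>carrier A. \<not> p (\<diamond>\<^bsub>A\<^esub>c) \<longrightarrow> c \<sqsubseteq>\<^bsub>A\<^esub> a) \<and>
        char_filter A p \<subseteq> F \<and> F \<subseteq> char_filter A p}"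

definition point_rel2 :: "('a, 'm) modal_order_scheme \<Rightarrow> ('a point2 \<times> 'a point2) set" where
  "point_rel2 A =
     {((p, a), (q, b)). \<not> q a \<and> (\<forall>c\<in>carrier A. p (\<box>\<^bsub>A\<^esub>c) \<le> q c)}"

definition point_rel3 :: "('a, 'm) modal_order_scheme \<Rightarrow> ('a point3 \<times> 'a point3) set" where
  "point_rel3 A =
     {((p, a, F), (q, b, G)). \<not> q a \<and> F \<subseteq> char_nabla A q}"

definition point_D2 :: "('a, 'm) modal_order_scheme \<Rightarrow> 'a point2 set \<Rightarrow> bool" where
  "point_D2 A P \<longleftrightarrow>
     (\<forall>(p, a)\<in>P. \<forall>c\<in>carrier A. \<not> c \<sqsubseteq>\<^bsub>A\<^esub> a \<longrightarrow>
        (\<exists>(q, b)\<in>P. ((p, a), (q, b)) \<in> point_rel2 A \<and> q c))"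

definition point_D3 :: "('a, 'm) modal_order_scheme \<Rightarrow> 'a point3 set \<Rightarrow> bool" where
  "point_D3 A P \<longleftrightarrow>
     (\<forall>(p, a, F)\<in>P. \<forall>c\<in>carrier A. \<not> c \<sqsubseteq>\<^bsub>A\<^esub> a \<longrightarrow>
        (\<exists>(q, b, G)\<in>P. ((p, a, F), (q, b, G)) \<in> point_rel3 A \<and> q c))"

definition point_B3 :: "('a, 'm) modal_order_scheme \<Rightarrow> 'a point3 set \<Rightarrow> bool" where
  "point_B3 A P \<longleftrightarrow>
     (\<forall>(p, a, F)\<in>P. \<forall>c\<in>carrier A. c \<notin> F \<longrightarrow>
        (\<exists>(q, b, G)\<in>P. ((p, a, F), (q, b, G)) \<in> point_rel3 A \<and> \<not> q c))"

text \<open>The conditions are closed under unions, so the unions below are the largest sets satisfying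
  them; see the lemmas \<open>points_RelSp_greatest\<close> etc.\<close>

definition points_RelSp :: "('a, 'm) modal_order_scheme \<Rightarrow> 'a point2 set" where
  "points_RelSp A = \<Union>{P. P \<subseteq> pre_points_RelSp A \<and> point_D2 A P}"

definition points_RelSpq :: "('a, 'm) modal_order_scheme \<Rightarrow> 'a point3 set" where
  "points_RelSpq A = \<Union>{P. P \<subseteq> pre_points_RelSpq A \<and> point_D3 A P \<and> point_B3 A P}"

definition points_RelSpqc :: "('a, 'm) modal_order_scheme \<Rightarrow> 'a point3 set" where
  "points_RelSpqc A = \<Union>{P. P \<subseteq> pre_points_RelSpqc A \<and> point_D3 A P \<and> point_B3 A P}"

lemma point_D2_Union:
  assumes "\<And>P. P \<in> \<P> \<Longrightarrow> point_D2 A P"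
  shows "point_D2 A (\<Union>\<P>)"
  unfolding point_D2_def
proof (clarify, goal_cases)
  case (1 p a P c)
  with assms obtain q b where "(q, b) \<in> P" "((p, a), (q, b)) \<in> point_rel2 A" "q c"
    unfolding point_D2_def by blast
  with \<open>P \<in> \<P>\<close> show ?case by blast
qed

lemma point_D3_Union:
  assumes "\<And>P. P \<in> \<P> \<Longrightarrow> point_D3 A P"
  shows "point_D3 A (\<Union>\<P>)"
  unfolding point_D3_def
proof (clarify, goal_cases)
  case (1 p a F P c)
  with assms obtain q b G
    where "(q, b, G) \<in> P" "((p, a, F), (q, b, G)) \<in> point_rel3 A" "q c"
    unfolding point_D3_def by blast
  with \<open>P \<in> \<P>\<close> show ?case by blast
qed

lemma point_B3_Union:
  assumes "\<And>P. P \<in> \<P> \<Longrightarrow> point_B3 A P"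
  shows "point_B3 A (\<Union>\<P>)"
  unfolding point_B3_def
proof (clarify, goal_cases)
  case (1 p a F P c)
  with assms obtain q b G
    where "(q, b, G) \<in> P" "((p, a, F), (q, b, G)) \<in> point_rel3 A" "\<not> q c"
    unfolding point_B3_def by blast
  with \<open>P \<in> \<P>\<close> show ?case by blast
qed

lemma points_RelSp_greatest:
  shows points_RelSp_subset: "points_RelSp A \<subseteq> pre_points_RelSp A"
    and points_RelSp_D: "point_D2 A (points_RelSp A)"
    and points_RelSp_upper:
      "\<lbrakk>P \<subseteq> pre_points_RelSp A; point_D2 A P\<rbrakk> \<Longrightarrow> P \<subseteq> points_RelSp A"
  unfolding points_RelSp_def
  by (rule Union_least, simp, rule point_D2_Union, simp, rule Union_upper, simp)

lemma points_RelSpq_greatest: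
  shows points_RelSpq_subset: "points_RelSpq A \<subseteq> pre_points_RelSpq A"
    and points_RelSpq_D: "point_D3 A (points_RelSpq A)"
    and points_RelSpq_B: "point_B3 A (points_RelSpq A)"
    and points_RelSpq_upper:
      "\<lbrakk>P \<subseteq> pre_points_RelSpq A; point_D3 A P; point_B3 A P\<rbrakk> \<Longrightarrow> P \<subseteq> points_RelSpq A"
  unfolding points_RelSpq_def
  by (rule Union_least, simp, rule point_D3_Union, simp, rule point_B3_Union, simp,
      rule Union_upper, simp)

lemma points_RelSpqc_greatest:
  shows points_RelSpqc_subset: "points_RelSpqc A \<subseteq> pre_points_RelSpqc A"
    and points_RelSpqc_D: "point_D3 A (points_RelSpqc A)"
    and points_RelSpqc_B: "point_B3 A (points_RelSpqc A)"
    and points_RelSpqc_upper: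
      "\<lbrakk>P \<subseteq> pre_points_RelSpqc A; point_D3 A P; point_B3 A P\<rbrakk> \<Longrightarrow> P \<subseteq> points_RelSpqc A"
  unfolding points_RelSpqc_def
  by (rule Union_least, simp, rule point_D3_Union, simp, rule point_B3_Union, simp,
      rule Union_upper, simp)


section \<open>The space of points\<close>

text \<open>The type variable \<open>'b\<close> stands for the components of a point after the frame character, so
  that the following applies to pairs and triples alike.\<close>

definition phi_on :: "(('a \<Rightarrow> bool) \<times> 'b) set \<Rightarrow> 'a \<Rightarrow> (('a \<Rightarrow> bool) \<times> 'b) set" where
  "phi_on P c = {x \<in> P. fst x c}"

definition point_space ::
    "('a, 'm) modal_order_scheme \<Rightarrow> (('a \<Rightarrow> bool) \<times> 'b) set \<Rightarrow>
     ((('a \<Rightarrow> bool) \<times> 'b) \<times> (('a \<Rightarrow> bool) \<times> 'b)) set \<Rightarrow> (('a \<Rightarrow> bool) \<times> 'b) rel_space" where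
  "point_space A P R =
     \<lparr>space_topology = topology (\<lambda>U. \<exists>c\<in>carrier A. U = phi_on P c),
      space_rel = R \<inter> (P \<times> P)\<rparr>"

definition F_RelSp :: "('a, 'm) modal_order_scheme \<Rightarrow> 'a point2 rel_space" where
  "F_RelSp A = point_space A (points_RelSp A) (point_rel2 A)"

definition phi_RelSp :: "('a, 'm) modal_order_scheme \<Rightarrow> 'a \<Rightarrow> 'a point2 set" where
  "phi_RelSp A = phi_on (points_RelSp A)"

definition F_RelSpq :: "('a, 'm) modal_order_scheme \<Rightarrow> 'a point3 rel_space" where
  "F_RelSpq A = point_space A (points_RelSpq A) (point_rel3 A)"

definition phi_RelSpq :: "('a, 'm) modal_order_scheme \<Rightarrow> 'a \<Rightarrow> 'a point3 set" where
  "phi_RelSpq A = phi_on (points_RelSpq A)"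

definition F_RelSpqc :: "('a, 'm) modal_order_scheme \<Rightarrow> 'a point3 rel_space" where
  "F_RelSpqc A = point_space A (points_RelSpqc A) (point_rel3 A)"

definition phi_RelSpqc :: "('a, 'm) modal_order_scheme \<Rightarrow> 'a \<Rightarrow> 'a point3 set" where
  "phi_RelSpqc A = phi_on (points_RelSpqc A)"

text \<open>Equivalence spaces use the same pre-points, hence the same space of points, as continuous
  relational spaces.\<close>

definition F_EqSpq :: "('a, 'm) modal_order_scheme \<Rightarrow> 'a point3 rel_space" where
  "F_EqSpq A = F_RelSpqc A"

definition phi_EqSpq :: "('a, 'm) modal_order_scheme \<Rightarrow> 'a \<Rightarrow> 'a point3 set" where
  "phi_EqSpq A = phi_RelSpqc A"

text \<open>The function \<^const>\<open>topology\<close> is only meaningful on families satisfying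
  \<^const>\<open>istopology\<close>; this holds for \<^const>\<open>point_space\<close> as first components of points are frame
  characters.\<close>

lemma complete_lattice_two: "complete_lattice two"
proof -
  interpret partial_order two
    by unfold_locales (auto simp: two_def)
  show ?thesis
  proof (rule complete_latticeI)
    fix S assume "S \<subseteq> carrier two"
    have "least two (\<exists>x\<in>S. x) (Upper two S)"
      by (auto simp: least_def Upper_def two_def)
    then show "\<exists>s. least two s (Upper two S)" ..
    have "greatest two (\<forall>x\<in>S. x) (Lower two S)"
      by (auto simp: greatest_def Lower_def two_def)
    then show "\<exists>i. greatest two i (Lower two S)" ..
  qed
qed

lemma sup_two: "\<Squnion>\<^bsub>two\<^esub>S = (\<exists>x\<in>S. x)"
proof -
  interpret complete_lattice two by (rule complete_lattice_two)
  have "least two (\<exists>x\<in>S. x) (Upper two S)"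
    by (auto simp: least_def Upper_def two_def)
  moreover have "least two (\<Squnion>\<^bsub>two\<^esub>S) (Upper two S)"
    by (rule sup_lub) (simp add: two_def)
  ultimately show ?thesis by (rule least_unique[symmetric])
qed

lemma meet_two: "x \<sqinter>\<^bsub>two\<^esub> y = (x \<and> y)"
proof -
  interpret complete_lattice two by (rule complete_lattice_two)
  have "greatest two (x \<and> y) (Lower two {x, y})"
    by (auto simp: greatest_def Lower_def two_def)
  moreover have "greatest two (x \<sqinter>\<^bsub>two\<^esub> y) (Lower two {x, y})"
    unfolding meet_def by (rule inf_glb) (simp add: two_def)
  ultimately show ?thesis by (rule greatest_unique[symmetric])
qed

lemma top_two: "\<top>\<^bsub>two\<^esub> = True"
proof -
  interpret complete_lattice two by (rule complete_lattice_two)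
  have "True \<sqsubseteq>\<^bsub>two\<^esub> \<top>\<^bsub>two\<^esub>"
    by (rule top_higher) (simp add: two_def)
  then show ?thesis by (simp add: two_def)
qed

lemma istopology_phi_on:
  assumes "frame A" and P: "\<forall>x\<in>P. frame_character A (fst x)"
  shows "istopology (\<lambda>U. \<exists>c\<in>carrier A. U = phi_on P c)"
proof -
  interpret frame A by fact
  have meet: "phi_on P c \<inter> phi_on P d = phi_on P (c \<sqinter>\<^bsub>A\<^esub> d)"
    if "c \<in> carrier A" "d \<in> carrier A" for c d
  proof -
    have "fst x (c \<sqinter>\<^bsub>A\<^esub> d) \<longleftrightarrow> fst x c \<and> fst x d" if "x \<in> P" for x
      using bspec[OF P that] \<open>c \<in> carrier A\<close> \<open>d \<in> carrier A\<close>
      unfolding frame_character_def frame_hom_def meet_pres_def meet_two by blast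
    then show ?thesis unfolding phi_on_def by blast
  qed
  have join: "\<Union>(phi_on P ` S) = phi_on P (\<Squnion>\<^bsub>A\<^esub>S)" if "S \<subseteq> carrier A" for S
  proof -
    have "fst x (\<Squnion>\<^bsub>A\<^esub>S) \<longleftrightarrow> (\<exists>c\<in>S. fst x c)" if "x \<in> P" for x
    proof -
      have "fst x (\<Squnion>\<^bsub>A\<^esub>S) = \<Squnion>\<^bsub>two\<^esub>(fst x ` S)"
        using bspec[OF P that] \<open>S \<subseteq> carrier A\<close>
        unfolding frame_character_def frame_hom_def sup_pres_def by blast
      then show ?thesis by (simp add: sup_two)
    qed
    then show ?thesis unfolding phi_on_def by blast
  qed
  show ?thesis
    unfolding istopology_def
  proof (intro conjI allI impI)
    fix U V assume "\<exists>c\<in>carrier A. U = phi_on P c" "\<exists>c\<in>carrier A. V = phi_on P c"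
    then obtain c d where "c \<in> carrier A" "U = phi_on P c" "d \<in> carrier A" "V = phi_on P d"
      by (elim bexE)
    then show "\<exists>c\<in>carrier A. U \<inter> V = phi_on P c"
      by (intro bexI[where x = "c \<sqinter>\<^bsub>A\<^esub> d"]) (simp_all only: meet meet_closed)
  next
    fix K assume K: "\<forall>U\<in>K. \<exists>c\<in>carrier A. U = phi_on P c"
    define S where "S = {c \<in> carrier A. phi_on P c \<in> K}"
    have S: "S \<subseteq> carrier A"
      by (auto simp: S_def)
    have "K = phi_on P ` S"
    proof
      show "K \<subseteq> phi_on P ` S"
      proof
        fix U assume "U \<in> K"
        with K obtain c where "c \<in> carrier A" "U = phi_on P c" by (elim ballE bexE) auto
        with \<open>U \<in> K\<close> show "U \<in> phi_on P ` S" by (simp add: S_def)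
      qed
    qed (auto simp: S_def)
    then have "\<Union>K = phi_on P (\<Squnion>\<^bsub>A\<^esub>S)"
      using join[OF S] by simp
    moreover have "\<Squnion>\<^bsub>A\<^esub>S \<in> carrier A"
      using S by (rule sup_closed)
    ultimately show "\<exists>c\<in>carrier A. \<Union>K = phi_on P c" by (rule bexI)
  qed
qed

lemma frame_character_points:
  "x \<in> points_RelSp A \<Longrightarrow> frame_character A (fst x)"
  "y \<in> points_RelSpq A \<Longrightarrow> frame_character A (fst y)"
  "y \<in> points_RelSpqc A \<Longrightarrow> frame_character A (fst y)"
proof -
  show "frame_character A (fst x)" if "x \<in> points_RelSp A"
    using subsetD[OF points_RelSp_subset that] by (auto simp: pre_points_RelSp_def)
  show "frame_character A (fst y)" if "y \<in> points_RelSpq A"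
    using subsetD[OF points_RelSpq_subset that] by (auto simp: pre_points_RelSpq_def)
  show "frame_character A (fst y)" if "y \<in> points_RelSpqc A"
    using subsetD[OF points_RelSpqc_subset that] by (auto simp: pre_points_RelSpqc_def)
qed

lemma openin_point_space:
  assumes "frame A" "\<forall>x\<in>P. frame_character A (fst x)"
  shows "openin (space_topology (point_space A P R)) U \<longleftrightarrow> (\<exists>c\<in>carrier A. U = phi_on P c)"
  using istopology_phi_on[OF assms] by (simp add: point_space_def)

lemma topspace_point_space:
  assumes "frame A" and P: "\<forall>x\<in>P. frame_character A (fst x)"
  shows "topspace (space_topology (point_space A P R)) = P"
proof -
  interpret frame A by fact
  have char: "fst x \<top>\<^bsub>A\<^esub>" if "x \<in> P" for x
    using bspec[OF P that] by (simp add: frame_character_def frame_hom_def top_two)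
  have "phi_on P \<top>\<^bsub>A\<^esub> = P"
    using char unfolding phi_on_def by blast
  then have "openin (space_topology (point_space A P R)) P"
    unfolding openin_point_space[OF assms]
    by (intro bexI[where x = "\<top>\<^bsub>A\<^esub>"]) simp_all
  then have "P \<subseteq> topspace (space_topology (point_space A P R))"
    by (rule openin_subset)
  moreover have "topspace (space_topology (point_space A P R)) \<subseteq> P"
    unfolding topspace_def openin_point_space[OF assms] by (auto simp: phi_on_def)
  ultimately show ?thesis by (rule equalityI[rotated])
qed

lemma relational_space_point_space:
  assumes "frame A" "\<forall>x\<in>P. frame_character A (fst x)"
  shows "relational_space (point_space A P R)"
  using topspace_point_space[OF assms, where R = R] unfolding relational_space_def
  by (auto simp: point_space_def)

end

theory Submission
  imports Defs
begin

text \<open>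
  Maximal elements outside a Scott-open filter are meet-prime; hence Zorn's lemma yields a frame
  character that contains a given Scott-open filter and omits a given element. If \<open>\<box>\<close> and \<open>\<diamond>\<close> preserve
  directed joins, then \<open>F\<^sub>p\<close> and the set of all \<open>c\<close> with \<open>p(\<diamond>c) = 1\<close> are Scott open. The successors
  required by (D) and (B) then exist at \<open>(p, x, F)\<close> whenever \<open>F\<close> is a Scott-open filter,
  \<open>c \<sqinter> d \<sqsubseteq> x\<close> with \<open>d \<in> F\<close> implies \<open>c \<sqsubseteq> x\<close>, and \<open>x \<squnion> c \<in> F\<close> implies \<open>c \<in> F\<close>. Such triples are
  obtained over every \<open>p\<close> by choosing \<open>x\<close> maximal outside a suitable Scott-open set and letting \<open>F\<close>
  be the set of all \<open>e\<close> with \<open>x \<squnion> e \<in> F\<^sub>p\<close>. There are enough of them to refute \<open>b \<sqsubseteq> \<box>a\<close> and \<open>b \<sqsubseteq> \<diamond>a\<close>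
  whenever these fail, so \<open>\<phi>\<close> is injective and commutes with \<open>\<box>\<close> and \<open>\<diamond>\<close>.
\<close>

section \<open>Frame homomorphisms\<close>

context frame
begin

lemma le_meet_iff:
  "\<lbrakk>x \<in> carrier L; y \<in> carrier L; z \<in> carrier L\<rbrakk> \<Longrightarrow> z \<sqsubseteq> x \<sqinter> y \<longleftrightarrow> z \<sqsubseteq> x \<and> z \<sqsubseteq> y"
  by (meson le_trans meet_closed meet_le meet_left meet_right)

lemma join_le_iff:
  "\<lbrakk>x \<in> carrier L; y \<in> carrier L; z \<in> carrier L\<rbrakk> \<Longrightarrow> x \<squnion> y \<sqsubseteq> z \<longleftrightarrow> x \<sqsubseteq> z \<and> y \<sqsubseteq> z"
  by (meson le_trans join_closed join_le join_left join_right)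

lemma le_joinI1: "\<lbrakk>z \<sqsubseteq> x; x \<in> carrier L; y \<in> carrier L; z \<in> carrier L\<rbrakk> \<Longrightarrow> z \<sqsubseteq> x \<squnion> y"
  by (rule le_trans[OF _ join_left]) simp_all

lemma le_joinI2: "\<lbrakk>z \<sqsubseteq> y; x \<in> carrier L; y \<in> carrier L; z \<in> carrier L\<rbrakk> \<Longrightarrow> z \<sqsubseteq> x \<squnion> y"
  by (rule le_trans[OF _ join_right]) simp_all

lemma sup_le_iff:
  assumes S: "S \<subseteq> carrier L" and z: "z \<in> carrier L"
  shows "\<Squnion>S \<sqsubseteq> z \<longleftrightarrow> (\<forall>x\<in>S. x \<sqsubseteq> z)"
proof (intro iffI ballI)
  fix x assume le: "\<Squnion>S \<sqsubseteq> z" and x: "x \<in> S"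
  show "x \<sqsubseteq> z"
    using S z subsetD[OF S x] by (intro le_trans[OF sup_upper[OF S x] le]) simp_all
next
  assume "\<forall>x\<in>S. x \<sqsubseteq> z"
  then show "\<Squnion>S \<sqsubseteq> z"
    by (intro sup_least S z) simp
qed

lemma meet_join_distrib:
  assumes "x \<in> carrier L" "y \<in> carrier L" "z \<in> carrier L"
  shows "x \<sqinter> (y \<squnion> z) = (x \<sqinter> y) \<squnion> (x \<sqinter> z)"
  using meet_sup_distrib[of x "{y, z}"] assms by (simp add: join_def)

text \<open>Finite distributivity is self-dual. In this form joining with \<open>x\<close> preserves
  binary meets, on which primality and the translated filters below rest.\<close>

lemma join_meet_distrib:
  assumes x: "x \<in> carrier L" and y: "y \<in> carrier L" and z: "z \<in> carrier L"
  shows "x \<squnion> (y \<sqinter> z) = (x \<squnion> y) \<sqinter> (x \<squnion> z)"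
proof (rule le_antisym)
  show "x \<squnion> (y \<sqinter> z) \<sqsubseteq> (x \<squnion> y) \<sqinter> (x \<squnion> z)"
    using assms by (simp add: le_meet_iff join_le_iff join_left le_joinI2 meet_left meet_right)
  have "(x \<squnion> y) \<sqinter> (x \<squnion> z) = ((x \<squnion> y) \<sqinter> x) \<squnion> (z \<sqinter> (x \<squnion> y))"
    using assms meet_join_distrib[of "x \<squnion> y" x z] by (simp add: meet_comm[of L "x \<squnion> y" z])
  also have "\<dots> = ((x \<squnion> y) \<sqinter> x) \<squnion> ((z \<sqinter> x) \<squnion> (z \<sqinter> y))"
    using assms by (simp add: meet_join_distrib)
  also have "\<dots> \<sqsubseteq> x \<squnion> (y \<sqinter> z)"
    using assms
    by (simp add: join_le_iff le_joinI1 le_joinI2 meet_right meet_comm[of L z y])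
  finally show "(x \<squnion> y) \<sqinter> (x \<squnion> z) \<sqsubseteq> x \<squnion> (y \<sqinter> z)"
    using assms by simp
qed (use assms in simp_all)

lemma sup_empty: "\<Squnion>{} = \<bottom>"
  using weak_sup_empty by (simp add: eq_is_equal)

end

section \<open>Elementary laws of frame homomorphisms\<close>

lemma frame_hom_closed: "\<lbrakk>frame_hom A B f; a \<in> carrier A\<rbrakk> \<Longrightarrow> f a \<in> carrier B"
  unfolding frame_hom_def by blast

lemma frame_hom_sup:
  "\<lbrakk>frame_hom A B f; S \<subseteq> carrier A\<rbrakk> \<Longrightarrow> f (\<Squnion>\<^bsub>A\<^esub>S) = \<Squnion>\<^bsub>B\<^esub>(f ` S)"
  unfolding frame_hom_def sup_pres_def by blast

lemma frame_hom_meet: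
  "\<lbrakk>frame_hom A B f; a \<in> carrier A; b \<in> carrier A\<rbrakk> \<Longrightarrow> f (a \<sqinter>\<^bsub>A\<^esub> b) = f a \<sqinter>\<^bsub>B\<^esub> f b"
  unfolding frame_hom_def meet_pres_def by blast

lemma frame_hom_top: "frame_hom A B f \<Longrightarrow> f \<top>\<^bsub>A\<^esub> = \<top>\<^bsub>B\<^esub>"
  unfolding frame_hom_def by blast

lemma frame_hom_join:
  "\<lbrakk>frame_hom A B f; a \<in> carrier A; b \<in> carrier A\<rbrakk> \<Longrightarrow> f (a \<squnion>\<^bsub>A\<^esub> b) = f a \<squnion>\<^bsub>B\<^esub> f b"
  using frame_hom_sup[of A B f "{a, b}"] by (simp add: join_def)

lemma frame_hom_bottom: "frame_hom A B f \<Longrightarrow> f \<bottom>\<^bsub>A\<^esub> = \<bottom>\<^bsub>B\<^esub>"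
  using frame_hom_sup[of A B f "{}"] frame.sup_empty[of A] frame.sup_empty[of B]
  by (simp add: frame_hom_def)

lemma frame_hom_mono:
  "\<lbrakk>frame_hom A B f; a \<in> carrier A; b \<in> carrier A; a \<sqsubseteq>\<^bsub>A\<^esub> b\<rbrakk> \<Longrightarrow> f a \<sqsubseteq>\<^bsub>B\<^esub> f b"
  using meet_pres_isotone[of f A B] unfolding frame_hom_def isotone_def by blast

lemma frame_homI:
  assumes "frame A" "frame B" "\<And>a. a \<in> carrier A \<Longrightarrow> f a \<in> carrier B"
    and "\<And>S. S \<subseteq> carrier A \<Longrightarrow> f (\<Squnion>\<^bsub>A\<^esub>S) = \<Squnion>\<^bsub>B\<^esub>(f ` S)"
    and "\<And>a b. \<lbrakk>a \<in> carrier A; b \<in> carrier A\<rbrakk> \<Longrightarrow> f (a \<sqinter>\<^bsub>A\<^esub> b) = f a \<sqinter>\<^bsub>B\<^esub> f b"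
    and "f \<top>\<^bsub>A\<^esub> = \<top>\<^bsub>B\<^esub>"
  shows "frame_hom A B f"
  using assms by (auto simp: frame_hom_def sup_pres_def meet_pres_def frame_def)

text \<open>Since all frame and modal axioms are (in)equalities between terms, a surjection that preserves
  the operations transfers them.\<close>

locale modal_surjection =
  A: modal_frame A + B: frame B
  for A :: "('a, 'm) modal_order_scheme" and B :: "('b, 'n) modal_order_scheme" +
  fixes f
  assumes hom: "frame_hom A B f"
    and surj: "f ` carrier A = carrier B"
    and f_box: "a \<in> carrier A \<Longrightarrow> f (\<box>\<^bsub>A\<^esub>a) = \<box>\<^bsub>B\<^esub>(f a)"
    and f_dia: "a \<in> carrier A \<Longrightarrow> f (\<diamond>\<^bsub>A\<^esub>a) = \<diamond>\<^bsub>B\<^esub>(f a)"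
begin

lemma box_closed: "a \<in> carrier A \<Longrightarrow> \<box>\<^bsub>A\<^esub>a \<in> carrier A"
  using A.mbox_closed by blast

lemma dia_closed: "a \<in> carrier A \<Longrightarrow> \<diamond>\<^bsub>A\<^esub>a \<in> carrier A"
  using A.mdia_closed by blast

lemmas preserves =
  frame_hom_meet[OF hom, symmetric] frame_hom_join[OF hom, symmetric]
  frame_hom_top[OF hom, symmetric] frame_hom_bottom[OF hom, symmetric]
  f_box[symmetric] f_dia[symmetric] box_closed dia_closed

lemma preimageE:
  assumes "x \<in> carrier B"
  obtains a where "a \<in> carrier A" "x = f a"
  using assms surj by blast

lemma preimage_leE:
  assumes "x \<in> carrier B" "y \<in> carrier B" "x \<sqsubseteq>\<^bsub>B\<^esub> y"
  obtains a b where "a \<in> carrier A" "b \<in> carrier A" "a \<sqsubseteq>\<^bsub>A\<^esub> b" "x = f a" "y = f b"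
proof -
  obtain a b where ab: "a \<in> carrier A" "b \<in> carrier A" "x = f a" "y = f b"
    using assms surj by blast
  show thesis
  proof (rule that)
    \<comment> \<open>Preimages of comparable elements need not be comparable. Replacing
      \<open>a\<close> by its meet with \<open>b\<close> makes them so and leaves the image
      \<open>x\<close> unchanged.\<close>
    show "x = f (a \<sqinter>\<^bsub>A\<^esub> b)"
      using B.le_iff_join assms ab frame_hom_meet[OF hom] by simp
  qed (use ab A.meet_right in simp_all)
qed

text \<open>Monotonicity of the modalities has an inequality as hypothesis, so it needs comparable
  preimages; the remaining inequalities are pulled back along arbitrary ones.\<close>

lemma modal_frame_target: "modal_frame B"
proof unfold_locales
  show "mbox B \<in> carrier B \<rightarrow> carrier B" "mdia B \<in> carrier B \<rightarrow> carrier B"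
    using frame_hom_closed[OF hom] by (auto elim!: preimageE simp: preserves)
  show "isotone B B (mbox B)"
  proof (rule isotoneI)
    fix x y assume "x \<in> carrier B" "y \<in> carrier B" "x \<sqsubseteq>\<^bsub>B\<^esub> y"
    then obtain a b where "a \<in> carrier A" "b \<in> carrier A" "a \<sqsubseteq>\<^bsub>A\<^esub> b" "x = f a" "y = f b"
      by (rule preimage_leE)
    then show "\<box>\<^bsub>B\<^esub>x \<sqsubseteq>\<^bsub>B\<^esub> \<box>\<^bsub>B\<^esub>y"
      by (simp add: preserves frame_hom_mono[OF hom] use_iso1[OF A.mbox_mono])
  qed (rule B.weak_partial_order_axioms)+
  show "isotone B B (mdia B)"
  proof (rule isotoneI)
    fix x y assume "x \<in> carrier B" "y \<in> carrier B" "x \<sqsubseteq>\<^bsub>B\<^esub> y"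
    then obtain a b where "a \<in> carrier A" "b \<in> carrier A" "a \<sqsubseteq>\<^bsub>A\<^esub> b" "x = f a" "y = f b"
      by (rule preimage_leE)
    then show "\<diamond>\<^bsub>B\<^esub>x \<sqsubseteq>\<^bsub>B\<^esub> \<diamond>\<^bsub>B\<^esub>y"
      by (simp add: preserves frame_hom_mono[OF hom] use_iso1[OF A.mdia_mono])
  qed (rule B.weak_partial_order_axioms)+
  show "\<top>\<^bsub>B\<^esub> \<sqsubseteq>\<^bsub>B\<^esub> \<box>\<^bsub>B\<^esub>\<top>\<^bsub>B\<^esub>" "\<diamond>\<^bsub>B\<^esub>\<bottom>\<^bsub>B\<^esub> \<sqsubseteq>\<^bsub>B\<^esub> \<bottom>\<^bsub>B\<^esub>"
    by (auto simp: preserves intro!: frame_hom_mono[OF hom] A.mbox_top A.mdia_bottom)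
  fix x y assume "x \<in> carrier B" "y \<in> carrier B"
  then show "\<box>\<^bsub>B\<^esub>x \<sqinter>\<^bsub>B\<^esub> \<box>\<^bsub>B\<^esub>y \<sqsubseteq>\<^bsub>B\<^esub> \<box>\<^bsub>B\<^esub>(x \<sqinter>\<^bsub>B\<^esub> y)"
    and "\<box>\<^bsub>B\<^esub>x \<sqinter>\<^bsub>B\<^esub> \<diamond>\<^bsub>B\<^esub>y \<sqsubseteq>\<^bsub>B\<^esub> \<diamond>\<^bsub>B\<^esub>(x \<sqinter>\<^bsub>B\<^esub> y)"
    by (auto elim!: preimageE simp: preserves
        intro!: frame_hom_mono[OF hom] A.mbox_meet A.mbox_mdia_meet)
qed

lemma convex_modal_frame_target:
  assumes "convex_modal_frame A"
  shows "convex_modal_frame B"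
proof -
  interpret C: convex_modal_frame A by fact
  interpret B: modal_frame B by (rule modal_frame_target)
  show ?thesis
    by unfold_locales
      (auto elim!: preimageE simp: preserves intro!: frame_hom_mono[OF hom] C.mdia_join C.mbox_join)
qed

lemma equivalence_frame_target:
  assumes "equivalence_frame A"
  shows "equivalence_frame B"
proof -
  interpret C: equivalence_frame A by fact
  interpret B: modal_frame B by (rule modal_frame_target)
  show ?thesis
    by unfold_locales
      (auto elim!: preimageE simp: preserves intro!: frame_hom_mono[OF hom] C.mbox_le C.le_mdia
        C.mbox_trans C.mdia_trans C.mdia_mbox_le C.le_mbox_mdia)
qed

lemma strict_MFrm_hom: "strict_MFrm_hom A B f"
proof -
  interpret B: modal_frame B by (rule modal_frame_target)
  have "f a \<in> carrier B" "\<box>\<^bsub>B\<^esub>(f a) \<in> carrier B" "\<diamond>\<^bsub>B\<^esub>(f a) \<in> carrier B" if "a \<in> carrier A" for a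
    using frame_hom_closed[OF hom that] B.mbox_closed B.mdia_closed by blast+
  then show ?thesis
    unfolding strict_MFrm_hom_def MFrm_hom_def
    using hom A.modal_frame_axioms modal_frame_target by (simp add: f_box f_dia)
qed

lemma strict_inverse:
  assumes inj: "inj_on f (carrier A)"
  shows "strict_MFrm_hom B A (inv_into (carrier A) f)"
    and "mutually_inverse A B f (inv_into (carrier A) f)"
proof -
  let ?g = "inv_into (carrier A) f"
  have gf: "?g (f a) = a" if "a \<in> carrier A" for a
    using inj that by simp
  have fg: "f (?g b) = b" and g: "?g b \<in> carrier A" if "b \<in> carrier B" for b
    using that surj by (simp_all add: f_inv_into_f inv_into_into)
  show "mutually_inverse A B f ?g"
    by (simp add: mutually_inverse_def gf fg)
  have "frame_hom B A ?g"
  proof (rule frame_homI)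
    fix S assume S: "S \<subseteq> carrier B"
    then have gS: "?g ` S \<subseteq> carrier A"
      using g by blast
    have "f ` ?g ` S = S"
      unfolding image_image using S fg by (simp add: subset_iff cong: image_cong_simp)
    then have "f (\<Squnion>\<^bsub>A\<^esub>(?g ` S)) = \<Squnion>\<^bsub>B\<^esub>S"
      using frame_hom_sup[OF hom gS] by simp
    then show "?g (\<Squnion>\<^bsub>B\<^esub>S) = \<Squnion>\<^bsub>A\<^esub>(?g ` S)"
      using gf[OF A.sup_closed[OF gS]] by simp
  next
    fix x y assume "x \<in> carrier B" "y \<in> carrier B"
    then show "?g (x \<sqinter>\<^bsub>B\<^esub> y) = ?g x \<sqinter>\<^bsub>A\<^esub> ?g y"
      by (auto elim!: preimageE simp: preserves gf)
  qed (use g gf[OF A.top_closed] in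
      \<open>simp_all add: A.frame_axioms B.frame_axioms frame_hom_top[OF hom, symmetric]\<close>)
  \<comment> \<open>The situation is now symmetric: the inverse is a surjection that preserves the
    operations, so its strictness follows from the lemma for \<open>f\<close>.\<close>
  then have "modal_surjection B A ?g"
    using modal_frame_target A.frame_axioms g gf
    by (auto simp: modal_surjection_def modal_surjection_axioms_def preserves elim!: preimageE
        intro!: image_eqI[OF _ frame_hom_closed[OF hom]])
  then show "strict_MFrm_hom B A ?g"
    by (rule modal_surjection.strict_MFrm_hom)
qed

end


section \<open>The modal frame of a relational space\<close>

lemma complete_lattice_Omega:
  shows "complete_lattice (Omega X)"
    and "S \<subseteq> carrier (Omega X) \<Longrightarrow> \<Squnion>\<^bsub>Omega X\<^esub>S = \<Union>S"
    and "\<lbrakk>U \<in> carrier (Omega X); V \<in> carrier (Omega X)\<rbrakk> \<Longrightarrow> U \<sqinter>\<^bsub>Omega X\<^esub> V = U \<inter> V"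
    and "\<top>\<^bsub>Omega X\<^esub> = topspace (space_topology X)"
proof -
  let ?T = "space_topology X"
  interpret partial_order "Omega X"
    by unfold_locales (auto simp: Omega_def)
  have lub: "least (Omega X) (\<Union>S) (Upper (Omega X) S)" if "S \<subseteq> carrier (Omega X)" for S
    using that by (auto simp: least_def Upper_def Omega_def)
  \<comment> \<open>Intersections of opens need not be open, so infima are interiors. Cutting down
    to the whole space covers the empty family.\<close>
  have glb: "greatest (Omega X) (?T interior_of (topspace ?T \<inter> \<Inter>S)) (Lower (Omega X) S)"
    if "S \<subseteq> carrier (Omega X)" for S
  proof -
    have "U \<subseteq> ?T interior_of (topspace ?T \<inter> \<Inter>S)"
      if "openin ?T U" "\<forall>V. V \<in> S \<and> openin ?T V \<longrightarrow> U \<subseteq> V" for U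
      using that \<open>S \<subseteq> carrier (Omega X)\<close> openin_subset[OF that(1)]
      by (intro interior_of_maximal) (auto simp: Omega_def)
    moreover have "?T interior_of (topspace ?T \<inter> \<Inter>S) \<subseteq> V" if "V \<in> S" for V
      using that interior_of_subset[of ?T "topspace ?T \<inter> \<Inter>S"] by blast
    ultimately show ?thesis
      using that by (auto simp: greatest_def Lower_def Omega_def)
  qed
  show cl: "complete_lattice (Omega X)"
    using lub glb by (intro complete_latticeI) blast+
  then interpret complete_lattice "Omega X" .
  show "\<Squnion>\<^bsub>Omega X\<^esub>S = \<Union>S" if "S \<subseteq> carrier (Omega X)"
    using least_unique[OF sup_lub[OF that] lub[OF that]] .
  show "U \<sqinter>\<^bsub>Omega X\<^esub> V = U \<inter> V" if "U \<in> carrier (Omega X)" "V \<in> carrier (Omega X)"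
  proof (rule le_antisym)
    show "U \<sqinter>\<^bsub>Omega X\<^esub> V \<sqsubseteq>\<^bsub>Omega X\<^esub> U \<inter> V"
      using meet_left[OF that] meet_right[OF that] by (simp add: Omega_def)
    show "U \<inter> V \<sqsubseteq>\<^bsub>Omega X\<^esub> U \<sqinter>\<^bsub>Omega X\<^esub> V"
      using that by (intro meet_le) (auto simp: Omega_def)
    show "U \<inter> V \<in> carrier (Omega X)"
      using that by (auto simp: Omega_def)
  qed (use that in simp)
  have "topspace ?T \<subseteq> \<top>\<^bsub>Omega X\<^esub>"
    using top_higher[of "topspace ?T"] by (simp add: Omega_def)
  moreover have "\<top>\<^bsub>Omega X\<^esub> \<subseteq> topspace ?T"
    using top_closed openin_subset by (fastforce simp: Omega_def)
  ultimately show "\<top>\<^bsub>Omega X\<^esub> = topspace ?T" by blast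
qed

lemmas Omega_sup = complete_lattice_Omega(2)
lemmas Omega_meet = complete_lattice_Omega(3)
lemmas Omega_top = complete_lattice_Omega(4)

lemma frame_Omega: "frame (Omega X)"
proof -
  interpret complete_lattice "Omega X" by (rule complete_lattice_Omega)
  show ?thesis
  proof
    fix U S assume U: "U \<in> carrier (Omega X)" and S: "S \<subseteq> carrier (Omega X)"
    have meet: "U \<sqinter>\<^bsub>Omega X\<^esub> V = U \<inter> V" if "V \<in> S" for V
      using U S that by (intro Omega_meet) auto
    have "(\<lambda>V. U \<sqinter>\<^bsub>Omega X\<^esub> V) ` S \<subseteq> carrier (Omega X)"
      using U S by auto
    then have "\<Squnion>\<^bsub>Omega X\<^esub>((\<lambda>V. U \<sqinter>\<^bsub>Omega X\<^esub> V) ` S) = (\<Union>V\<in>S. U \<sqinter>\<^bsub>Omega X\<^esub> V)"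
      by (rule Omega_sup)
    also have "\<dots> = U \<inter> \<Union>S"
      using meet by auto
    also have "\<dots> = U \<sqinter>\<^bsub>Omega X\<^esub> \<Union>S"
      using Omega_meet[OF U] sup_closed[OF S] S by (simp add: Omega_sup)
    finally show "U \<sqinter>\<^bsub>Omega X\<^esub> (\<Squnion>\<^bsub>Omega X\<^esub>S) = \<Squnion>\<^bsub>Omega X\<^esub>((\<lambda>V. U \<sqinter>\<^bsub>Omega X\<^esub> V) ` S)"
      using S by (simp add: Omega_sup)
  qed
qed


section \<open>Representing a modal frame by points\<close>

context frame
begin

text \<open>Joins in \<open>two\<close> are disjunctions and meets are conjunctions, so a character
  is the indicator of a completely prime filter.\<close>

lemma frame_character_iff:
  "frame_character L p \<longleftrightarrow>
     p \<in> extensional (carrier L) \<and> (\<forall>S\<subseteq>carrier L. p (\<Squnion>S) = (\<exists>x\<in>S. p x)) \<and>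
     (\<forall>x\<in>carrier L. \<forall>y\<in>carrier L. p (x \<sqinter> y) = (p x \<and> p y)) \<and> p \<top>"
proof -
  interpret two: complete_lattice two by (rule complete_lattice_two)
  have "frame two"
    by unfold_locales (simp add: sup_two meet_two)
  moreover have "carrier two = UNIV"
    by (simp add: two_def)
  moreover have "lattice two" "lattice L" ..
  ultimately show ?thesis
    unfolding frame_character_def frame_hom_def sup_pres_def meet_pres_def
    using frame_axioms complete_lattice_two complete_lattice_axioms
    by (simp add: sup_two meet_two top_two) blast
qed

lemma character_sup:
  "\<lbrakk>frame_character L p; S \<subseteq> carrier L\<rbrakk> \<Longrightarrow> p (\<Squnion>S) \<longleftrightarrow> (\<exists>x\<in>S. p x)"
  and character_meet:
  "\<lbrakk>frame_character L p; x \<in> carrier L; y \<in> carrier L\<rbrakk> \<Longrightarrow> p (x \<sqinter> y) \<longleftrightarrow> p x \<and> p y"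
  and character_top: "frame_character L p \<Longrightarrow> p \<top>"
  by (simp_all add: frame_character_iff)

lemma character_join:
  "\<lbrakk>frame_character L p; x \<in> carrier L; y \<in> carrier L\<rbrakk> \<Longrightarrow> p (x \<squnion> y) \<longleftrightarrow> p x \<or> p y"
  using character_sup[of p "{x, y}"] by (simp add: join_def)

lemma character_bottom: "frame_character L p \<Longrightarrow> \<not> p \<bottom>"
  using character_sup[of p "{}"] by (simp add: sup_empty)

lemma character_mono:
  "\<lbrakk>frame_character L p; x \<in> carrier L; y \<in> carrier L; x \<sqsubseteq> y; p x\<rbrakk> \<Longrightarrow> p y"
  using character_meet[of p x y] le_iff_join[of x y] by simp

end

text \<open>What a set of points must provide for \<open>phi_on P\<close> to be an isomorphism.
  Separation gives injectivity; the forward conditions place the image of \<open>\<box>a\<close> or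
  \<open>\<diamond>a\<close> inside the relational box or diamond; the witnesses show that no larger
  open set fits, so that this image is the interior.\<close>

locale modal_representation = modal_frame A for A :: "('a, 'm) modal_order_scheme" (structure) +
  fixes P :: "(('a \<Rightarrow> bool) \<times> 'b) set" and R
  assumes character: "x \<in> P \<Longrightarrow> frame_character A (fst x)"
    and separating:
      "\<lbrakk>a \<in> carrier A; b \<in> carrier A; \<not> a \<sqsubseteq> b\<rbrakk> \<Longrightarrow> \<exists>x\<in>P. fst x a \<and> \<not> fst x b"
    and box_forward:
      "\<lbrakk>x \<in> P; y \<in> P; (x, y) \<in> R; a \<in> carrier A; fst x (\<box>a)\<rbrakk> \<Longrightarrow> fst y a"
    and box_witness:
      "\<lbrakk>a \<in> carrier A; b \<in> carrier A; \<not> b \<sqsubseteq> \<box>a\<rbrakk> \<Longrightarrow>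
        \<exists>x\<in>P. fst x b \<and> (\<exists>y\<in>P. (x, y) \<in> R \<and> \<not> fst y a)"
    and dia_forward:
      "\<lbrakk>x \<in> P; a \<in> carrier A; fst x (\<diamond>a)\<rbrakk> \<Longrightarrow> \<exists>y\<in>P. (x, y) \<in> R \<and> fst y a"
    and dia_witness:
      "\<lbrakk>a \<in> carrier A; b \<in> carrier A; \<not> b \<sqsubseteq> \<diamond>a\<rbrakk> \<Longrightarrow>
        \<exists>x\<in>P. fst x b \<and> (\<forall>y\<in>P. (x, y) \<in> R \<longrightarrow> \<not> fst y a)"
begin

abbreviation "X \<equiv> point_space A P R"

lemma character_ball: "\<forall>x\<in>P. frame_character A (fst x)"
  using character by blast

lemmas openin_X = openin_point_space[OF frame_axioms character_ball, of R]
lemmas topspace_X = topspace_point_space[OF frame_axioms character_ball, of R]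

lemma carrier_Omega_X: "carrier (Omega X) = phi_on P ` carrier A"
  by (auto simp: Omega_def openin_X)

lemma mem_rel_box: "x \<in> rel_box X U \<longleftrightarrow> x \<in> P \<and> (\<forall>y\<in>P. (x, y) \<in> R \<longrightarrow> y \<in> U)"
  unfolding rel_box_def topspace_X by (auto simp: point_space_def)

lemma mem_rel_dia: "x \<in> rel_dia X U \<longleftrightarrow> x \<in> P \<and> (\<exists>y\<in>P. (x, y) \<in> R \<and> y \<in> U)"
  unfolding rel_dia_def topspace_X by (auto simp: point_space_def)

lemma mem_phi_on: "x \<in> phi_on P a \<longleftrightarrow> x \<in> P \<and> fst x a"
  by (simp add: phi_on_def)

lemma phi_on_subset_iff:
  "\<lbrakk>a \<in> carrier A; b \<in> carrier A\<rbrakk> \<Longrightarrow> phi_on P a \<subseteq> phi_on P b \<longleftrightarrow> a \<sqsubseteq> b"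
  using separating[of a b] character_mono[OF character, of _ a b] unfolding phi_on_def by blast

lemma frame_hom_phi_on: "frame_hom A (Omega X) (phi_on P)"
proof (rule frame_homI)
  fix S assume S: "S \<subseteq> carrier A"
  have "phi_on P (\<Squnion>S) = \<Union>(phi_on P ` S)"
    using character_sup[OF character S] unfolding phi_on_def by blast
  also have "\<dots> = \<Squnion>\<^bsub>Omega X\<^esub>(phi_on P ` S)"
    using S by (intro Omega_sup[symmetric]) (auto simp: carrier_Omega_X)
  finally show "phi_on P (\<Squnion>S) = \<Squnion>\<^bsub>Omega X\<^esub>(phi_on P ` S)" .
next
  fix a b assume ab: "a \<in> carrier A" "b \<in> carrier A"
  have "phi_on P (a \<sqinter> b) = phi_on P a \<inter> phi_on P b"
    using character_meet[OF character ab] unfolding phi_on_def by blast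
  also have "\<dots> = phi_on P a \<sqinter>\<^bsub>Omega X\<^esub> phi_on P b"
    using ab by (intro Omega_meet[symmetric]) (auto simp: carrier_Omega_X)
  finally show "phi_on P (a \<sqinter> b) = phi_on P a \<sqinter>\<^bsub>Omega X\<^esub> phi_on P b" .
next
  show "phi_on P \<top> = \<top>\<^bsub>Omega X\<^esub>"
    using character_top[OF character] unfolding Omega_top topspace_X phi_on_def by blast
qed (auto simp: frame_axioms frame_Omega carrier_Omega_X)

text \<open>Every open set has the form \<open>\<phi>(b)\<close>, so the interiors of \<open>\<box>\<^sub>R\<close> and \<open>\<diamond>\<^sub>R\<close> can be tested
  against these.\<close>

lemma phi_on_box:
  assumes a: "a \<in> carrier A"
  shows "phi_on P (\<box>a) = \<box>\<^bsub>Omega X\<^esub>(phi_on P a)"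
proof -
  have ba: "\<box>a \<in> carrier A"
    using a mbox_closed by blast
  have "space_topology X interior_of rel_box X (phi_on P a) = phi_on P (\<box>a)"
  proof (rule interior_of_unique)
    show "phi_on P (\<box>a) \<subseteq> rel_box X (phi_on P a)"
      using box_forward[OF _ _ _ a] by (auto simp: subset_iff mem_rel_box mem_phi_on)
    show "openin (space_topology X) (phi_on P (\<box>a))"
      using ba openin_X by blast
    fix U assume U: "U \<subseteq> rel_box X (phi_on P a)" "openin (space_topology X) U"
    then obtain b where b: "b \<in> carrier A" "U = phi_on P b"
      using openin_X by blast
    have "b \<sqsubseteq> \<box>a"
    proof (rule ccontr)
      assume "\<not> b \<sqsubseteq> \<box>a"
      from box_witness[OF a b(1) this] U(1) show False
        unfolding b(2) subset_iff mem_rel_box mem_phi_on by blast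
    qed
    then show "U \<subseteq> phi_on P (\<box>a)"
      using phi_on_subset_iff b ba by simp
  qed
  then show ?thesis by (simp add: Omega_def)
qed

lemma phi_on_dia:
  assumes a: "a \<in> carrier A"
  shows "phi_on P (\<diamond>a) = \<diamond>\<^bsub>Omega X\<^esub>(phi_on P a)"
proof -
  have da: "\<diamond>a \<in> carrier A"
    using a mdia_closed by blast
  have "space_topology X interior_of rel_dia X (phi_on P a) = phi_on P (\<diamond>a)"
  proof (rule interior_of_unique)
    show "phi_on P (\<diamond>a) \<subseteq> rel_dia X (phi_on P a)"
      using dia_forward[OF _ a] by (auto simp: subset_iff mem_rel_dia mem_phi_on)
    show "openin (space_topology X) (phi_on P (\<diamond>a))"
      using da openin_X by blast
    fix U assume U: "U \<subseteq> rel_dia X (phi_on P a)" "openin (space_topology X) U"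
    then obtain b where b: "b \<in> carrier A" "U = phi_on P b"
      using openin_X by blast
    have "b \<sqsubseteq> \<diamond>a"
    proof (rule ccontr)
      assume "\<not> b \<sqsubseteq> \<diamond>a"
      from dia_witness[OF a b(1) this] U(1) show False
        unfolding b(2) subset_iff mem_rel_dia mem_phi_on by blast
    qed
    then show "U \<subseteq> phi_on P (\<diamond>a)"
      using phi_on_subset_iff b da by simp
  qed
  then show ?thesis by (simp add: Omega_def)
qed

lemma modal_surjection_phi_on: "modal_surjection A (Omega X) (phi_on P)"
proof (rule modal_surjection.intro)
  show "modal_surjection_axioms A (Omega X) (phi_on P)"
    by (rule modal_surjection_axioms.intro[OF frame_hom_phi_on carrier_Omega_X[symmetric]
          phi_on_box phi_on_dia])
  show "frame (Omega X)" by (rule frame_Omega)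
qed (rule modal_frame_axioms)

lemma inj_phi_on: "inj_on (phi_on P) (carrier A)"
  by (rule inj_onI, rule le_antisym) (simp_all flip: phi_on_subset_iff)

lemmas strict_phi_on = modal_surjection.strict_MFrm_hom[OF modal_surjection_phi_on]
  modal_surjection.strict_inverse[OF modal_surjection_phi_on inj_phi_on]

lemmas convex_modal_frame_Omega_X =
  modal_surjection.convex_modal_frame_target[OF modal_surjection_phi_on]

lemmas equivalence_frame_Omega_X =
  modal_surjection.equivalence_frame_target[OF modal_surjection_phi_on]

lemma MFrm_iso_phi_on: "MFrm_iso A (Omega X) (phi_on P)"
  using strict_phi_on unfolding MFrm_iso_def strict_MFrm_hom_def by blast

lemma CMFrm_iso_phi_on: "convex_modal_frame A \<Longrightarrow> CMFrm_iso A (Omega X) (phi_on P)"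
  using strict_phi_on convex_modal_frame_Omega_X unfolding CMFrm_iso_def CMFrm_hom_def by blast

lemma CEqFrm_iso_phi_on:
  assumes "convex_equivalence_frame A"
  shows "CEqFrm_iso A (Omega X) (phi_on P)"
proof -
  have "convex_modal_frame A" "equivalence_frame A"
    using assms by (simp_all add: convex_equivalence_frame_def)
  then have "convex_equivalence_frame (Omega X)"
    by (intro convex_equivalence_frame.intro convex_modal_frame_Omega_X equivalence_frame_Omega_X)
  then show ?thesis
    using assms strict_phi_on unfolding CEqFrm_iso_def CEqFrm_hom_def by blast
qed

end


section \<open>Scott-open filters and frame characters\<close>

definition scott_open :: "('a, 'm) gorder_scheme \<Rightarrow> 'a set \<Rightarrow> bool" where
  "scott_open A H \<longleftrightarrow>
     H \<subseteq> carrier A \<and> (\<forall>x\<in>H. \<forall>y\<in>carrier A. x \<sqsubseteq>\<^bsub>A\<^esub> y \<longrightarrow> y \<in> H) \<and>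
     (\<forall>S. directed A S \<and> \<Squnion>\<^bsub>A\<^esub>S \<in> H \<longrightarrow> (\<exists>s\<in>S. s \<in> H))"

lemma scott_openI:
  assumes "H \<subseteq> carrier A"
    and "\<And>x y. \<lbrakk>x \<in> H; y \<in> carrier A; x \<sqsubseteq>\<^bsub>A\<^esub> y\<rbrakk> \<Longrightarrow> y \<in> H"
    and "\<And>S. \<lbrakk>directed A S; \<Squnion>\<^bsub>A\<^esub>S \<in> H\<rbrakk> \<Longrightarrow> \<exists>s\<in>S. s \<in> H"
  shows "scott_open A H"
  using assms unfolding scott_open_def by blast

lemma scott_open_carrier: "\<lbrakk>scott_open A H; x \<in> H\<rbrakk> \<Longrightarrow> x \<in> carrier A"
  unfolding scott_open_def by blast

lemma scott_open_up: "\<lbrakk>scott_open A H; x \<in> H; x \<sqsubseteq>\<^bsub>A\<^esub> y; y \<in> carrier A\<rbrakk> \<Longrightarrow> y \<in> H"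
  unfolding scott_open_def by blast

lemma scott_open_directed: "\<lbrakk>scott_open A H; directed A S; \<Squnion>\<^bsub>A\<^esub>S \<in> H\<rbrakk> \<Longrightarrow> \<exists>s\<in>S. s \<in> H"
  unfolding scott_open_def by blast

lemma scott_open_Un: "\<lbrakk>scott_open A H; scott_open A H'\<rbrakk> \<Longrightarrow> scott_open A (H \<union> H')"
  by (rule scott_openI) (auto dest: scott_open_carrier scott_open_up scott_open_directed)

lemma lattice_filterI:
  assumes "F \<subseteq> carrier A" "u \<in> F"
    and "\<And>x y. \<lbrakk>x \<in> F; y \<in> carrier A; x \<sqsubseteq>\<^bsub>A\<^esub> y\<rbrakk> \<Longrightarrow> y \<in> F"
    and "\<And>x y. \<lbrakk>x \<in> F; y \<in> F\<rbrakk> \<Longrightarrow> x \<sqinter>\<^bsub>A\<^esub> y \<in> F"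
  shows "lattice_filter A F"
  using assms unfolding lattice_filter_def by blast

lemma lattice_filter_carrier: "\<lbrakk>lattice_filter A F; x \<in> F\<rbrakk> \<Longrightarrow> x \<in> carrier A"
  unfolding lattice_filter_def by blast

lemma lattice_filter_up: "\<lbrakk>lattice_filter A F; x \<in> F; x \<sqsubseteq>\<^bsub>A\<^esub> y; y \<in> carrier A\<rbrakk> \<Longrightarrow> y \<in> F"
  unfolding lattice_filter_def by blast

lemma lattice_filter_meet: "\<lbrakk>lattice_filter A F; x \<in> F; y \<in> F\<rbrakk> \<Longrightarrow> x \<sqinter>\<^bsub>A\<^esub> y \<in> F"
  unfolding lattice_filter_def by blast

lemma directed_carrier: "directed A S \<Longrightarrow> S \<subseteq> carrier A"
  unfolding directed_def by blast

context frame
begin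

lemma lattice_filter_top: "lattice_filter L F \<Longrightarrow> \<top> \<in> F"
  unfolding lattice_filter_def using top_closed top_higher by blast

lemma meet_mono:
  "\<lbrakk>x \<sqsubseteq> x'; y \<sqsubseteq> y'; x \<in> carrier L; x' \<in> carrier L; y \<in> carrier L; y' \<in> carrier L\<rbrakk> \<Longrightarrow>
    x \<sqinter> y \<sqsubseteq> x' \<sqinter> y'"
  by (simp add: le_meet_iff le_trans[OF meet_left] le_trans[OF meet_right])

lemma join_mono_right:
  "\<lbrakk>y \<sqsubseteq> y'; x \<in> carrier L; y \<in> carrier L; y' \<in> carrier L\<rbrakk> \<Longrightarrow> x \<squnion> y \<sqsubseteq> x \<squnion> y'"
  by (simp add: join_le_iff join_left le_joinI2)

text \<open>The complement of a Scott-open set is closed under joins of nonempty chains, so Zorn's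
  lemma applies to its elements above \<open>x\<close>. Anything strictly above \<open>m\<close>
  lies in \<open>H\<close>, in particular \<open>m \<squnion> y\<close>.\<close>

lemma scott_open_maximal:
  assumes H: "scott_open L H" and x: "x \<in> carrier L" "x \<notin> H"
  obtains m where "m \<in> carrier L" "x \<sqsubseteq> m" "m \<notin> H"
    "\<And>y. \<lbrakk>y \<in> carrier L; \<not> y \<sqsubseteq> m\<rbrakk> \<Longrightarrow> m \<squnion> y \<in> H"
proof -
  define Z where "Z = {y \<in> carrier L. x \<sqsubseteq> y \<and> y \<notin> H}"
  have ZL: "z \<in> carrier L" if "z \<in> Z" for z
    using that by (simp add: Z_def)
  have "\<exists>m\<in>Z. \<forall>y\<in>Z. m \<sqsubseteq> y \<longrightarrow> y = m"
  proof (rule predicate_Zorn)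
    show "partial_order_on Z (relation_of (\<sqsubseteq>) Z)"
    proof (rule partial_order_on_relation_ofI)
      fix a b c assume "a \<in> Z" "b \<in> Z" "c \<in> Z" "a \<sqsubseteq> b" "b \<sqsubseteq> c"
      then show "a \<sqsubseteq> c"
        by (simp add: ZL le_trans[of a b c])
    next
      fix a b assume "a \<in> Z" "b \<in> Z" "a \<sqsubseteq> b" "b \<sqsubseteq> a"
      then show "a = b"
        by (simp add: ZL le_antisym)
    qed (simp add: ZL)
    fix C assume C: "C \<in> Chains (relation_of (\<sqsubseteq>) Z)"
    show "\<exists>u\<in>Z. \<forall>y\<in>C. y \<sqsubseteq> u"
    proof (cases "C = {}")
      \<comment> \<open>The join of the empty chain is \<bottom>, which need not lie above
        \<open>x\<close>, so \<open>x\<close> itself serves as the bound. Nonempty chains are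
        directed and are bounded by their join.\<close>
      case True
      then show ?thesis using x by (intro bexI[of _ x]) (simp_all add: Z_def)
    next
      case False
      have CZ: "C \<subseteq> Z"
        by (rule Chains_relation_of[OF C])
      have CL: "C \<subseteq> carrier L"
        using CZ ZL by blast
      have "y \<sqsubseteq> z \<or> z \<sqsubseteq> y" if "y \<in> C" "z \<in> C" for y z
        using C that unfolding Chains_def relation_of_def by blast
      moreover have "y \<sqsubseteq> y" if "y \<in> C" for y
        using CL that le_refl by blast
      ultimately have dir: "directed L C"
        unfolding directed_def using False CL by blast
      obtain y where y: "y \<in> C"
        using False by blast
      have "x \<sqsubseteq> \<Squnion>C"
      proof (rule le_trans)
        show "x \<sqsubseteq> y" "y \<in> carrier L"
          using y CZ by (auto simp: Z_def)
        show "y \<sqsubseteq> \<Squnion>C"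
          using CL y by (rule sup_upper)
      qed (use x CL in simp_all)
      moreover have "\<Squnion>C \<notin> H"
        using scott_open_directed[OF H dir] CZ unfolding Z_def by blast
      ultimately have "\<Squnion>C \<in> Z"
        using CL by (simp add: Z_def)
      then show ?thesis
        using sup_upper[OF CL] by blast
    qed
  qed
  then obtain m where m: "m \<in> Z" and max: "\<And>y. \<lbrakk>y \<in> Z; m \<sqsubseteq> y\<rbrakk> \<Longrightarrow> y = m"
    by blast
  have mL: "m \<in> carrier L" "x \<sqsubseteq> m" "m \<notin> H"
    using m by (simp_all add: Z_def)
  show thesis
  proof (rule that)
    fix y assume y: "y \<in> carrier L" "\<not> y \<sqsubseteq> m"
    then have "m \<squnion> y \<noteq> m"
      using mL join_right[of m y] by auto
    then have "m \<squnion> y \<notin> Z"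
      using max join_left[OF mL(1) y(1)] by blast
    then show "m \<squnion> y \<in> H"
      using mL y x by (simp add: Z_def le_joinI1)
  qed (use mL in simp_all)
qed

text \<open>Let \<open>m\<close> be maximal outside \<open>G\<close>. If neither \<open>a\<close>
  nor \<open>b\<close> is below \<open>m\<close>, then \<open>m \<squnion> a\<close> and
  \<open>m \<squnion> b\<close> lie in \<open>G\<close>, hence so does their meet
  \<open>m \<squnion> (a \<sqinter> b)\<close>, and \<open>a \<sqinter> b\<close> is not below
  \<open>m\<close>. So \<open>m\<close> is meet-prime and not being below \<open>m\<close> defines a
  character.\<close>

lemma scott_open_filter_separation:
  assumes G: "lattice_filter L G" "scott_open L G" and x: "x \<in> carrier L" "x \<notin> G"
  obtains q where "frame_character L q" "G \<subseteq> char_nabla L q" "\<not> q x"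
proof -
  obtain m where m: "m \<in> carrier L" "x \<sqsubseteq> m" "m \<notin> G"
    and max: "\<And>y. \<lbrakk>y \<in> carrier L; \<not> y \<sqsubseteq> m\<rbrakk> \<Longrightarrow> m \<squnion> y \<in> G"
    using scott_open_maximal[OF G(2) x] by blast
  define q where "q = restrict (\<lambda>e. \<not> e \<sqsubseteq> m) (carrier L)"
  have q: "q e \<longleftrightarrow> \<not> e \<sqsubseteq> m" if "e \<in> carrier L" for e
    using that by (simp add: q_def)
  have above: "\<not> e \<sqsubseteq> m" if "e \<in> G" for e
    using lattice_filter_up[OF G(1) that _ m(1)] m(3) by blast
  have prime: "a \<sqsubseteq> m \<or> b \<sqsubseteq> m" if ab: "a \<in> carrier L" "b \<in> carrier L" "a \<sqinter> b \<sqsubseteq> m" for a b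
  proof (rule ccontr)
    assume "\<not> (a \<sqsubseteq> m \<or> b \<sqsubseteq> m)"
    then have "(m \<squnion> a) \<sqinter> (m \<squnion> b) \<in> G"
      using max ab by (intro lattice_filter_meet[OF G(1)]) simp_all
    then have "m \<squnion> (a \<sqinter> b) \<in> G"
      using join_meet_distrib m ab by simp
    then have "\<not> m \<squnion> (a \<sqinter> b) \<sqsubseteq> m"
      by (rule above)
    then show False
      using m ab by (simp add: join_le_iff)
  qed
  show thesis
  proof
    show "frame_character L q"
      unfolding frame_character_iff
    proof (intro conjI allI impI ballI)
      show "q \<in> extensional (carrier L)"
        by (simp add: q_def)
      fix S assume S: "S \<subseteq> carrier L"
      then have "(\<exists>e\<in>S. q e) \<longleftrightarrow> (\<exists>e\<in>S. \<not> e \<sqsubseteq> m)"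
        using q by blast
      then show "q (\<Squnion>S) = (\<exists>e\<in>S. q e)"
        using q sup_le_iff[OF S m(1)] S by simp
    next
      fix a b assume ab: "a \<in> carrier L" "b \<in> carrier L"
      then show "q (a \<sqinter> b) = (q a \<and> q b)"
        using q prime[OF ab] le_trans[OF meet_left[OF ab], of m] le_trans[OF meet_right[OF ab], of m]
          m(1) by (metis meet_closed)
    next
      show "q \<top>"
        using q above lattice_filter_top[OF G(1)] by simp
    qed
    show "G \<subseteq> char_nabla L q"
      by (rule subsetI) (simp add: char_nabla_def above q lattice_filter_carrier[OF G(1)])
    show "\<not> q x"
      using q x m by simp
  qed
qed

text \<open>Joining with \<open>x\<close> is Scott continuous. The inequality lets an up-closed set
  pass from \<open>x \<squnion> \<Squnion>S\<close> to the join of the translates; it rests on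
  \<open>S\<close> being nonempty, as otherwise that join would be \<bottom>.\<close>

lemma directed_join:
  assumes S: "directed L S" and x: "x \<in> carrier L"
  shows "directed L ((\<lambda>s. x \<squnion> s) ` S)"
    and "x \<squnion> \<Squnion>S \<sqsubseteq> \<Squnion>((\<lambda>s. x \<squnion> s) ` S)"
proof -
  have SL: "s \<in> carrier L" if "s \<in> S" for s
    using directed_carrier[OF S] that by blast
  have ne: "S \<noteq> {}"
    using S by (simp add: directed_def)
  have dir: "\<exists>u\<in>S. s \<sqsubseteq> u \<and> t \<sqsubseteq> u" if "s \<in> S" "t \<in> S" for s t
    using S that unfolding directed_def by blast
  have im: "(\<lambda>s. x \<squnion> s) ` S \<subseteq> carrier L"
    using SL x by auto
  have "\<exists>u\<in>S. x \<squnion> s \<sqsubseteq> x \<squnion> u \<and> x \<squnion> t \<sqsubseteq> x \<squnion> u" if "s \<in> S" "t \<in> S" for s t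
    using dir[OF that] join_mono_right[OF _ x] SL that by metis
  then show "directed L ((\<lambda>s. x \<squnion> s) ` S)"
    unfolding directed_def using im ne by simp
  have *: "x \<sqsubseteq> \<Squnion>((\<lambda>s. x \<squnion> s) ` S)" "s \<sqsubseteq> \<Squnion>((\<lambda>s. x \<squnion> s) ` S)" if "s \<in> S" for s
  proof -
    have "x \<squnion> s \<sqsubseteq> \<Squnion>((\<lambda>s. x \<squnion> s) ` S)"
      using im that by (intro sup_upper) simp_all
    then show "x \<sqsubseteq> \<Squnion>((\<lambda>s. x \<squnion> s) ` S)" "s \<sqsubseteq> \<Squnion>((\<lambda>s. x \<squnion> s) ` S)"
      using im SL[OF that] x by (simp_all add: join_le_iff)
  qed
  then show "x \<squnion> \<Squnion>S \<sqsubseteq> \<Squnion>((\<lambda>s. x \<squnion> s) ` S)"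
    using ne x im directed_carrier[OF S] by (auto simp: join_le_iff sup_le_iff)
qed

text \<open>This is the inverse image of \<open>H\<close> under the Scott-continuous map that joins
  with \<open>x\<close>.\<close>

lemma scott_open_join:
  assumes H: "scott_open L H" and x: "x \<in> carrier L"
  shows "scott_open L {e \<in> carrier L. x \<squnion> e \<in> H}"
proof (rule scott_openI)
  fix e e' assume "e \<in> {e \<in> carrier L. x \<squnion> e \<in> H}" "e' \<in> carrier L" "e \<sqsubseteq> e'"
  then show "e' \<in> {e \<in> carrier L. x \<squnion> e \<in> H}"
    using scott_open_up[OF H _ join_mono_right, of x e e'] x by simp
next
  fix S assume S: "directed L S" "\<Squnion>S \<in> {e \<in> carrier L. x \<squnion> e \<in> H}"
  have SL: "S \<subseteq> carrier L"
    using S(1) by (rule directed_carrier)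
  have im: "(\<lambda>s. x \<squnion> s) ` S \<subseteq> carrier L"
    using SL x by auto
  have "\<Squnion>((\<lambda>s. x \<squnion> s) ` S) \<in> H"
    using S(2) scott_open_up[OF H _ directed_join(2)[OF S(1) x]] im by simp
  then show "\<exists>s\<in>S. s \<in> {e \<in> carrier L. x \<squnion> e \<in> H}"
    using scott_open_directed[OF H directed_join(1)[OF S(1) x]] SL by blast
qed simp

text \<open>By distributivity, joining with \<open>x\<close> preserves binary meets, so filters pull
  back to filters.\<close>

lemma lattice_filter_join:
  assumes F: "lattice_filter L F" and x: "x \<in> carrier L"
  shows "lattice_filter L {e \<in> carrier L. x \<squnion> e \<in> F}"
proof (rule lattice_filterI)
  show "\<top> \<in> {e \<in> carrier L. x \<squnion> e \<in> F}"
    using lattice_filter_up[OF F lattice_filter_top[OF F]] x by (simp add: join_right)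
next
  fix e e' assume "e \<in> {e \<in> carrier L. x \<squnion> e \<in> F}" "e' \<in> carrier L" "e \<sqsubseteq> e'"
  then show "e' \<in> {e \<in> carrier L. x \<squnion> e \<in> F}"
    using lattice_filter_up[OF F _ join_mono_right, of x e e'] x by simp
next
  fix e e' assume "e \<in> {e \<in> carrier L. x \<squnion> e \<in> F}" "e' \<in> {e \<in> carrier L. x \<squnion> e \<in> F}"
  then show "e \<sqinter> e' \<in> {e \<in> carrier L. x \<squnion> e \<in> F}"
    using lattice_filter_meet[OF F, of "x \<squnion> e" "x \<squnion> e'"] x by (simp add: join_meet_distrib)
qed simp

end

section \<open>Compact elements and extension of Scott-open filters\<close>

context spectral_frame
begin

lemma compact_closed: "k \<in> compact_elements A \<Longrightarrow> k \<in> carrier A"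
  by (simp add: compact_elements_def)

lemma compactD:
  "\<lbrakk>k \<in> compact_elements A; directed A S; k \<sqsubseteq> \<Squnion>S\<rbrakk> \<Longrightarrow> \<exists>s\<in>S. k \<sqsubseteq> s"
  by (simp add: compact_elements_def)

text \<open>Directed sets are nonempty, and any member lies above \<bottom>.\<close>

lemma bottom_compact: "\<bottom> \<in> compact_elements A"
  unfolding compact_elements_def directed_def using bottom_lower bottom_closed by blast

lemma join_compact:
  assumes k: "k \<in> compact_elements A" and l: "l \<in> compact_elements A"
  shows "k \<squnion> l \<in> compact_elements A"
proof -
  note [simp] = compact_closed[OF k] compact_closed[OF l]
  have "\<exists>s\<in>S. k \<squnion> l \<sqsubseteq> s" if S: "directed A S" and le: "k \<squnion> l \<sqsubseteq> \<Squnion>S" for S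
  proof -
    have SA: "S \<subseteq> carrier A"
      using S by (rule directed_carrier)
    have "k \<sqsubseteq> \<Squnion>S" "l \<sqsubseteq> \<Squnion>S"
      using le SA by (simp_all add: join_le_iff)
    then obtain s t where st: "s \<in> S" "k \<sqsubseteq> s" "t \<in> S" "l \<sqsubseteq> t"
      using compactD[OF k S] compactD[OF l S] by blast
    then obtain u where u: "u \<in> S" "s \<sqsubseteq> u" "t \<sqsubseteq> u"
      using S unfolding directed_def by blast
    have "s \<in> carrier A" "t \<in> carrier A" "u \<in> carrier A"
      using SA st u by blast+
    then show ?thesis
      using u(1) le_trans[OF st(2) u(2)] le_trans[OF st(4) u(3)]
      by (intro bexI[of _ u]) (simp_all add: join_le_iff)
  qed
  then show ?thesis
    by (simp add: compact_elements_def)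
qed

lemma not_le_compact:
  assumes a: "a \<in> carrier A" and b: "b \<in> carrier A" and "\<not> a \<sqsubseteq> b"
  obtains k where "k \<in> compact_elements A" "k \<sqsubseteq> a" "\<not> k \<sqsubseteq> b"
proof -
  obtain S where S: "S \<subseteq> compact_elements A" "a = \<Squnion>S"
    using join_of_compacts[OF a] by blast
  then have SA: "S \<subseteq> carrier A"
    using compact_closed by blast
  obtain k where "k \<in> S" "\<not> k \<sqsubseteq> b"
    using sup_le_iff[OF SA b] S(2) assms(3) by blast
  then show thesis
    using that S sup_upper[OF SA] by blast
qed

text \<open>Compact elements are closed under finite joins, which turns the given join of compacts
  into a directed one.\<close>

lemma directed_compacts_below:
  assumes a: "a \<in> carrier A"
  shows "directed A {k \<in> compact_elements A. k \<sqsubseteq> a}" (is "directed A ?K")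
    and "\<Squnion>{k \<in> compact_elements A. k \<sqsubseteq> a} = a"
proof -
  have K: "?K \<subseteq> carrier A"
    using compact_closed by blast
  have "\<exists>z\<in>?K. k \<sqsubseteq> z \<and> l \<sqsubseteq> z" if "k \<in> ?K" "l \<in> ?K" for k l
    using that a compact_closed join_compact
    by (intro bexI[of _ "k \<squnion> l"]) (simp_all add: join_le_iff join_left join_right)
  moreover have "\<bottom> \<in> ?K"
    using a bottom_compact by simp
  ultimately show "directed A ?K"
    unfolding directed_def using K by blast
  show "\<Squnion>?K = a"
  proof (rule le_antisym)
    show "\<Squnion>?K \<sqsubseteq> a"
      using sup_le_iff[OF K a] by simp
    show "a \<sqsubseteq> \<Squnion>?K"
    proof (rule ccontr)
      assume le: "\<not> a \<sqsubseteq> \<Squnion>?K"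
      obtain k where "k \<in> compact_elements A" "k \<sqsubseteq> a" "\<not> k \<sqsubseteq> \<Squnion>?K"
        by (rule not_le_compact[OF a sup_closed[OF K] le])
      then show False
        using sup_upper[OF K, of k] by simp
    qed
  qed (use a K in simp_all)
qed

text \<open>Scott openness is applied to \<open>a\<close> as the directed join of the compacts below
  it.\<close>

lemma scott_open_compact:
  assumes "scott_open A H" "a \<in> H"
  obtains k where "k \<in> compact_elements A" "k \<sqsubseteq> a" "k \<in> H"
proof -
  have a: "a \<in> carrier A"
    by (rule scott_open_carrier[OF assms])
  have "\<exists>k\<in>{k \<in> compact_elements A. k \<sqsubseteq> a}. k \<in> H"
    using assms a
    by (intro scott_open_directed[OF assms(1) directed_compacts_below(1)])
      (simp_all add: directed_compacts_below(2))
  then show thesis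
    by (auto intro: that)
qed

text \<open>The filter generated by \<open>F\<close> and a compact element is again Scott open, because \<open>F\<close> has a
  basis of compact elements and these are closed under meets.\<close>

lemma character_extending_filter:
  assumes F: "lattice_filter A F" "scott_open A F"
    and c: "c \<in> carrier A" and x: "x \<in> carrier A"
    and avoid: "\<And>k d. \<lbrakk>k \<in> carrier A; d \<in> F; k \<sqinter> d \<sqsubseteq> x\<rbrakk> \<Longrightarrow> k \<sqsubseteq> x"
    and "\<not> c \<sqsubseteq> x"
  obtains q where "frame_character A q" "F \<subseteq> char_nabla A q" "q c" "\<not> q x"
proof -
  \<comment> \<open>Passing from \<open>c\<close> to a compact \<open>k\<close> below it makes the
    generated filter \<open>G\<close> Scott open; \<open>G\<close> still contains
    \<open>c\<close>.\<close>
  obtain k where k: "k \<in> compact_elements A" "k \<sqsubseteq> c" "\<not> k \<sqsubseteq> x"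
    by (rule not_le_compact[OF c x \<open>\<not> c \<sqsubseteq> x\<close>])
  have kA: "k \<in> carrier A"
    using k(1) by (rule compact_closed)
  have FA: "d \<in> carrier A" if "d \<in> F" for d
    using lattice_filter_carrier[OF F(1) that] .
  define G where "G = {e \<in> carrier A. \<exists>d\<in>F. k \<sqinter> d \<sqsubseteq> e}"
  have GI: "e \<in> G" if "e \<in> carrier A" "d \<in> F" "k \<sqinter> d \<sqsubseteq> e" for e d
    using that unfolding G_def by blast
  have GE: thesis if "e \<in> G" "\<And>d. \<lbrakk>e \<in> carrier A; d \<in> F; k \<sqinter> d \<sqsubseteq> e\<rbrakk> \<Longrightarrow> thesis" for e thesis
    using that unfolding G_def by blast
  have topF: "\<top> \<in> F"
    by (rule lattice_filter_top[OF F(1)])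
  have up: "e' \<in> G" if "e \<in> G" "e' \<in> carrier A" "e \<sqsubseteq> e'" for e e'
    using that(1)
  proof (rule GE)
    fix d assume d: "e \<in> carrier A" "d \<in> F" "k \<sqinter> d \<sqsubseteq> e"
    show "e' \<in> G"
      using le_trans[OF d(3) that(3)] that(2) d kA FA by (intro GI[of _ d]) simp_all
  qed
  have "lattice_filter A G"
  proof (rule lattice_filterI)
    show "G \<subseteq> carrier A"
      unfolding G_def by blast
    show "\<top> \<in> G"
      using topF kA by (intro GI[of _ \<top>]) simp_all
    fix e e' assume "e \<in> G" "e' \<in> G"
    then obtain d d' where d: "e \<in> carrier A" "e' \<in> carrier A" "d \<in> F" "d' \<in> F"
      "k \<sqinter> d \<sqsubseteq> e" "k \<sqinter> d' \<sqsubseteq> e'"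
      unfolding G_def by blast
    note [simp] = kA FA[OF d(3)] FA[OF d(4)] d(1,2)
    have "k \<sqinter> (d \<sqinter> d') \<sqsubseteq> e"
      by (rule le_trans[OF meet_mono d(5)]) (simp_all add: meet_left)
    moreover have "k \<sqinter> (d \<sqinter> d') \<sqsubseteq> e'"
      by (rule le_trans[OF meet_mono d(6)]) (simp_all add: meet_right)
    ultimately show "e \<sqinter> e' \<in> G"
      using lattice_filter_meet[OF F(1) d(3,4)] by (intro GI[of _ "d \<sqinter> d'"]) (simp_all add: le_meet_iff)
  qed (rule up)
  moreover have "scott_open A G"
  proof (rule scott_openI)
    show "G \<subseteq> carrier A"
      unfolding G_def by blast
    fix S assume S: "directed A S" "\<Squnion>S \<in> G"
    have SA: "S \<subseteq> carrier A"
      using S(1) by (rule directed_carrier)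
    obtain d where d: "d \<in> F" "k \<sqinter> d \<sqsubseteq> \<Squnion>S"
      using S(2) unfolding G_def by blast
    \<comment> \<open>Shrinking \<open>d\<close> to a compact \<open>l\<close> in \<open>F\<close>
      makes \<open>k \<sqinter> l\<close> compact, so that it lies below a single member of
      \<open>S\<close>.\<close>
    obtain l where l: "l \<in> compact_elements A" "l \<sqsubseteq> d" "l \<in> F"
      by (rule scott_open_compact[OF F(2) d(1)])
    have "k \<sqinter> l \<sqsubseteq> \<Squnion>S"
      using l kA FA[OF d(1)] FA[OF l(3)] SA
      by (intro le_trans[OF meet_mono d(2)]) simp_all
    then obtain s where s: "s \<in> S" "k \<sqinter> l \<sqsubseteq> s"
      using compactD[OF meet_compact[OF k(1) l(1)] S(1)] by blast
    then show "\<exists>s\<in>S. s \<in> G"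
      using GI[OF _ l(3)] SA by blast
  qed (rule up)
  \<comment> \<open>Otherwise \<open>k \<sqinter> d \<sqsubseteq> x\<close> for some
    \<open>d\<close> in \<open>F\<close>, and \<open>avoid\<close> would force
    \<open>k \<sqsubseteq> x\<close>.\<close>
  moreover have "x \<notin> G"
    using avoid[OF kA] k(3) unfolding G_def by blast
  ultimately obtain q where q: "frame_character A q" "G \<subseteq> char_nabla A q" "\<not> q x"
    using scott_open_filter_separation x by blast
  show thesis
  proof
    show "F \<subseteq> char_nabla A q"
    proof
      fix d assume d: "d \<in> F"
      then have "d \<in> G"
        using kA FA by (intro GI[of _ d]) (simp_all add: meet_right)
      then show "d \<in> char_nabla A q"
        using q(2) by blast
    qed
    have "c \<in> G"
      using topF kA c le_trans[OF meet_left k(2), of \<top>] by (intro GI[of _ \<top>]) simp_all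
    then show "q c"
      using q(2) unfolding char_nabla_def by blast
  qed (use q in simp_all)
qed

text \<open>The filter \<open>{\<top>}\<close> is Scott open because \<top> is compact, so it can be
  extended by \<open>a\<close> while \<open>b\<close> is omitted.\<close>

lemma character_separation:
  assumes a: "a \<in> carrier A" and b: "b \<in> carrier A" and "\<not> a \<sqsubseteq> b"
  obtains p where "frame_character A p" "p a" "\<not> p b"
proof -
  have top: "x = \<top>" if "x \<in> carrier A" "\<top> \<sqsubseteq> x" for x
    using that by (intro le_antisym) simp_all
  have "\<top> \<sqinter> \<top> = \<top>"
    using le_iff_join[of \<top> \<top>] by simp
  then have "lattice_filter A {\<top>}"
    by (intro lattice_filterI[of _ _ \<top>]) (simp_all add: top)
  moreover have "scott_open A {\<top>}"
  proof (rule scott_openI)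
    fix S assume S: "directed A S" "\<Squnion>S \<in> {\<top>}"
    then obtain s where s: "s \<in> S" "\<top> \<sqsubseteq> s"
      using compactD[OF top_compact S(1)] by auto
    then have "s = \<top>"
      using directed_carrier[OF S(1)] by (intro top) auto
    then show "\<exists>s\<in>S. s \<in> {\<top>}"
      using s(1) by blast
  qed (simp_all add: top)
  ultimately show thesis
  proof (rule character_extending_filter[OF _ _ a b _ assms(3)])
    fix k d assume k: "k \<in> carrier A" "d \<in> {\<top>}" "k \<sqinter> d \<sqsubseteq> b"
    then have "k \<sqinter> \<top> = k"
      using le_iff_join[of k \<top>] by simp
    then show "k \<sqsubseteq> b"
      using k by simp
  qed (rule that)
qed

end


section \<open>Saturated triples\<close>

text \<open>Conditions that suffice for the clauses (D) and (B) to hold with some frame character \<open>q\<close>.\<close>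

definition saturated :: "('a, 'm) modal_order_scheme \<Rightarrow> 'a point3 set" where
  "saturated A =
     {(p, x, F). (p, x, F) \<in> pre_points_RelSpq A \<and> scott_open A F \<and>
        (\<forall>c\<in>carrier A. \<forall>d\<in>F. c \<sqinter>\<^bsub>A\<^esub> d \<sqsubseteq>\<^bsub>A\<^esub> x \<longrightarrow> c \<sqsubseteq>\<^bsub>A\<^esub> x) \<and>
        (\<forall>c\<in>carrier A. x \<squnion>\<^bsub>A\<^esub> c \<in> F \<longrightarrow> c \<in> F)}"

lemma pre_points_RelSpqD:
  assumes "(p, x, F) \<in> pre_points_RelSpq A"
  shows "frame_character A p" "x \<in> carrier A" "lattice_filter A F"
    "\<not> p (\<diamond>\<^bsub>A\<^esub>x)" "char_filter A p \<subseteq> F"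
  using assms by (simp_all add: pre_points_RelSpq_def)

lemma saturatedD:
  assumes "(p, x, F) \<in> saturated A"
  shows "(p, x, F) \<in> pre_points_RelSpq A" "scott_open A F"
    "\<lbrakk>c \<in> carrier A; d \<in> F; c \<sqinter>\<^bsub>A\<^esub> d \<sqsubseteq>\<^bsub>A\<^esub> x\<rbrakk> \<Longrightarrow> c \<sqsubseteq>\<^bsub>A\<^esub> x"
    "\<lbrakk>c \<in> carrier A; x \<squnion>\<^bsub>A\<^esub> c \<in> F\<rbrakk> \<Longrightarrow> c \<in> F"
  using assms by (auto simp: saturated_def)

lemma saturatedI:
  assumes "(p, x, F) \<in> pre_points_RelSpq A" "scott_open A F"
    and "\<And>c d. \<lbrakk>c \<in> carrier A; d \<in> F; c \<sqinter>\<^bsub>A\<^esub> d \<sqsubseteq>\<^bsub>A\<^esub> x\<rbrakk> \<Longrightarrow> c \<sqsubseteq>\<^bsub>A\<^esub> x"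
    and "\<And>c. \<lbrakk>c \<in> carrier A; x \<squnion>\<^bsub>A\<^esub> c \<in> F\<rbrakk> \<Longrightarrow> c \<in> F"
  shows "(p, x, F) \<in> saturated A"
  unfolding saturated_def using assms by blast

lemma mem_point_rel3:
  "((p, x, F), (q, y, G)) \<in> point_rel3 A \<longleftrightarrow> \<not> q x \<and> F \<subseteq> char_nabla A q"
  by (simp add: point_rel3_def)

lemma point_D2E:
  assumes "point_D2 A P" "(p, x) \<in> P" "c \<in> carrier A" "\<not> c \<sqsubseteq>\<^bsub>A\<^esub> x"
  obtains q y where "(q, y) \<in> P" "((p, x), (q, y)) \<in> point_rel2 A" "q c"
  using assms unfolding point_D2_def by fast

lemma point_D3E:
  assumes "point_D3 A P" "(p, x, F) \<in> P" "c \<in> carrier A" "\<not> c \<sqsubseteq>\<^bsub>A\<^esub> x"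
  obtains q y G where "(q, y, G) \<in> P" "((p, x, F), (q, y, G)) \<in> point_rel3 A" "q c"
  using assms unfolding point_D3_def by fast

lemma point_B3E:
  assumes "point_B3 A P" "(p, x, F) \<in> P" "c \<in> carrier A" "c \<notin> F"
  obtains q y G where "(q, y, G) \<in> P" "((p, x, F), (q, y, G)) \<in> point_rel3 A" "\<not> q c"
  using assms unfolding point_B3_def by fast

section \<open>Composites of a frame character with the modalities, and saturated triples\<close>

context modally_spectral_frame
begin

lemma box_closed: "a \<in> carrier A \<Longrightarrow> \<box>a \<in> carrier A"
  using mbox_closed by (rule funcset_mem)

lemma dia_closed: "a \<in> carrier A \<Longrightarrow> \<diamond>a \<in> carrier A"
  using mdia_closed by (rule funcset_mem)

lemma character_box_mono:
  "\<lbrakk>frame_character A p; p (\<box>a); a \<sqsubseteq> b; a \<in> carrier A; b \<in> carrier A\<rbrakk> \<Longrightarrow> p (\<box>b)"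
  by (rule character_mono[OF _ _ _ use_iso1[OF mbox_mono]]) (simp_all add: box_closed)

lemma character_dia_mono:
  "\<lbrakk>frame_character A p; p (\<diamond>a); a \<sqsubseteq> b; a \<in> carrier A; b \<in> carrier A\<rbrakk> \<Longrightarrow> p (\<diamond>b)"
  by (rule character_mono[OF _ _ _ use_iso1[OF mdia_mono]]) (simp_all add: dia_closed)

lemma character_box_meet:
  "\<lbrakk>frame_character A p; p (\<box>a); p (\<box>b); a \<in> carrier A; b \<in> carrier A\<rbrakk> \<Longrightarrow> p (\<box>(a \<sqinter> b))"
  by (rule character_mono[OF _ _ _ mbox_meet]) (simp_all add: box_closed character_meet)

lemma character_box_dia_meet:
  "\<lbrakk>frame_character A p; p (\<box>a); p (\<diamond>b); a \<in> carrier A; b \<in> carrier A\<rbrakk> \<Longrightarrow> p (\<diamond>(a \<sqinter> b))"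
  by (rule character_mono[OF _ _ _ mbox_mdia_meet])
    (simp_all add: box_closed dia_closed character_meet)

lemma character_dia_bottom: "frame_character A p \<Longrightarrow> \<not> p (\<diamond>\<bottom>)"
  using character_mono[OF _ _ _ mdia_bottom, of p] character_bottom[of p]
  by (auto simp: dia_closed)

text \<open>\<open>\<box>\<close> preserves directed joins and \<open>p\<close> preserves all joins.
  From this \<open>char_filter A p\<close> inherits Scott openness.\<close>

lemma character_box_directed:
  assumes p: "frame_character A p" and S: "directed A S" and "p (\<box>(\<Squnion>S))"
  shows "\<exists>s\<in>S. p (\<box>s)"
proof -
  have "mbox A ` S \<subseteq> carrier A"
    using box_closed directed_carrier[OF S] by blast
  then show ?thesis
    using character_sup[OF p] assms(3) by (simp add: mbox_directed[OF S])
qed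

lemma character_dia_directed:
  assumes p: "frame_character A p" and S: "directed A S" and "p (\<diamond>(\<Squnion>S))"
  shows "\<exists>s\<in>S. p (\<diamond>s)"
proof -
  have "mdia A ` S \<subseteq> carrier A"
    using dia_closed directed_carrier[OF S] by blast
  then show ?thesis
    using character_sup[OF p] assms(3) by (simp add: mdia_directed[OF S])
qed

lemma mem_char_filter: "c \<in> char_filter A p \<longleftrightarrow> c \<in> carrier A \<and> p (\<box>c)"
  by (simp add: char_filter_def)

lemma lattice_filter_char_filter:
  assumes p: "frame_character A p"
  shows "lattice_filter A (char_filter A p)"
proof (rule lattice_filterI)
  have "p (\<box>\<top>)"
    by (rule character_mono[OF p _ _ mbox_top]) (simp_all add: character_top[OF p] box_closed)
  then show "\<top> \<in> char_filter A p"
    by (simp add: mem_char_filter)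
qed (auto simp: mem_char_filter character_box_meet[OF p] intro: character_box_mono[OF p])

lemma scott_open_char_filter:
  assumes p: "frame_character A p"
  shows "scott_open A (char_filter A p)"
proof (rule scott_openI)
  fix S assume S: "directed A S" "\<Squnion>S \<in> char_filter A p"
  then show "\<exists>s\<in>S. s \<in> char_filter A p"
    using character_box_directed[OF p S(1)] directed_carrier[OF S(1)]
    by (auto simp: mem_char_filter)
qed (auto simp: mem_char_filter intro: character_box_mono[OF p])

lemma scott_open_dia:
  assumes p: "frame_character A p"
  shows "scott_open A {e \<in> carrier A. p (\<diamond>e)}"
proof (rule scott_openI)
  fix S assume S: "directed A S" "\<Squnion>S \<in> {e \<in> carrier A. p (\<diamond>e)}"
  then show "\<exists>s\<in>S. s \<in> {e \<in> carrier A. p (\<diamond>e)}"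
    using character_dia_directed[OF p S(1)] directed_carrier[OF S(1)] by auto
qed (auto intro: character_dia_mono[OF p])

text \<open>The axiom linking \<open>\<box>\<close> and \<open>\<diamond>\<close> makes the set of
  all \<open>e\<close> with \<open>p (\<diamond>e)\<close> stable under meets with members of
  \<open>char_filter A p\<close>.\<close>

lemma character_dia_char_filter:
  "\<lbrakk>frame_character A p; p (\<diamond>e); d \<in> char_filter A p; e \<in> carrier A\<rbrakk> \<Longrightarrow> p (\<diamond>(e \<sqinter> d))"
  using character_box_dia_meet[of p d e] meet_comm[of A e d] by (simp add: mem_char_filter)

text \<open>Take \<open>x\<close> maximal above \<open>a\<close> outside \<open>H\<close>. Since
  \<open>H\<close> contains every \<open>e\<close> with \<open>p (\<diamond>e)\<close>, the
  character vanishes at \<open>\<diamond>x\<close>. Stability of \<open>H\<close> gives the meet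
  condition of saturation, and idempotence of joining with \<open>x\<close> gives the join
  condition.\<close>

lemma saturated_extension:
  assumes p: "frame_character A p" and H: "scott_open A H"
    and dia: "\<And>e. \<lbrakk>e \<in> carrier A; p (\<diamond>e)\<rbrakk> \<Longrightarrow> e \<in> H"
    and stable: "\<And>e d. \<lbrakk>e \<in> H; d \<in> char_filter A p\<rbrakk> \<Longrightarrow> e \<sqinter> d \<in> H"
    and a: "a \<in> carrier A" "a \<notin> H"
  obtains x where "a \<sqsubseteq> x" "x \<in> carrier A" "x \<notin> H"
    "(p, x, {e \<in> carrier A. x \<squnion> e \<in> char_filter A p}) \<in> saturated A"
proof -
  let ?P = "char_filter A p"
  obtain x where x: "x \<in> carrier A" "a \<sqsubseteq> x" "x \<notin> H"
    and max: "\<And>y. \<lbrakk>y \<in> carrier A; \<not> y \<sqsubseteq> x\<rbrakk> \<Longrightarrow> x \<squnion> y \<in> H"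
    using scott_open_maximal[OF H a] by blast
  let ?F = "{e \<in> carrier A. x \<squnion> e \<in> ?P}"
  note P = lattice_filter_char_filter[OF p] scott_open_char_filter[OF p]
  show thesis
  proof (rule that[OF x(2,1,3)])
    have "?P \<subseteq> ?F"
    proof
      fix e assume e: "e \<in> ?P"
      then have "e \<in> carrier A"
        by (rule lattice_filter_carrier[OF P(1)])
      then show "e \<in> ?F"
        using lattice_filter_up[OF P(1) e join_right[of x e]] x by simp
    qed
    moreover have "\<not> p (\<diamond>x)"
      using dia x by blast
    ultimately have pre: "(p, x, ?F) \<in> pre_points_RelSpq A"
      using p x(1) lattice_filter_join[OF P(1) x(1)] by (simp add: pre_points_RelSpq_def)
    show "(p, x, ?F) \<in> saturated A"
    proof (rule saturatedI[OF pre scott_open_join[OF P(2) x(1)]])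
      fix c d assume c: "c \<in> carrier A" and d: "d \<in> ?F" and le: "c \<sqinter> d \<sqsubseteq> x"
      show "c \<sqsubseteq> x"
      proof (rule ccontr)
        assume "\<not> c \<sqsubseteq> x"
        \<comment> \<open>Maximality puts \<open>x \<squnion> c\<close> in \<open>H\<close>, and
          \<open>x \<squnion> d\<close> lies in \<open>char_filter A p\<close> by choice of the
          filter, so stability applies. By distributivity the meet is
          \<open>x \<squnion> (c \<sqinter> d)\<close>, which is below \<open>x\<close> although
          \<open>x\<close> is outside \<open>H\<close>.\<close>
        then have "(x \<squnion> c) \<sqinter> (x \<squnion> d) \<in> H"
          using max c d by (intro stable) simp_all
        then have "x \<squnion> (c \<sqinter> d) \<in> H"
          using x c d by (simp add: join_meet_distrib)
        moreover have "x \<squnion> (c \<sqinter> d) \<sqsubseteq> x"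
          using x c d le by (simp add: join_le_iff)
        ultimately show False
          using scott_open_up[OF H] x by simp
      qed
    next
      fix c assume c: "c \<in> carrier A" and xc: "x \<squnion> c \<in> ?F"
      have "x \<squnion> (x \<squnion> c) = x \<squnion> c"
        using le_iff_meet[of x "x \<squnion> c"] x c by (simp add: join_left)
      then show "c \<in> ?F"
        using xc c by simp
    qed
  qed
qed

text \<open>Here \<open>H\<close> is as small as possible: it consists of the \<open>e\<close> with
  \<open>p (\<diamond>e)\<close>.\<close>

lemma saturated_above:
  assumes p: "frame_character A p" and a: "a \<in> carrier A" "\<not> p (\<diamond>a)"
  obtains x F where "(p, x, F) \<in> saturated A" "a \<sqsubseteq> x"
proof (rule saturated_extension[OF p scott_open_dia[OF p]])
  show "e \<sqinter> d \<in> {e \<in> carrier A. p (\<diamond>e)}"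
    if "e \<in> {e \<in> carrier A. p (\<diamond>e)}" "d \<in> char_filter A p" for e d
    using that character_dia_char_filter[OF p, of e d] by (simp add: mem_char_filter)
qed (use a that in auto)

text \<open>The set \<open>H\<close> is enlarged by all \<open>e\<close> with
  \<open>a \<squnion> e\<close> in \<open>char_filter A p\<close>. That \<open>x\<close> avoids
  these says precisely that \<open>a\<close> is not in the resulting filter. Stability of the second
  part is again distributivity.\<close>

lemma saturated_avoiding:
  assumes p: "frame_character A p" and a: "a \<in> carrier A" "\<not> p (\<box>a)"
  obtains x F where "(p, x, F) \<in> saturated A" "a \<notin> F"
proof -
  let ?D = "{e \<in> carrier A. p (\<diamond>e)}"
  let ?B = "{e \<in> carrier A. a \<squnion> e \<in> char_filter A p}"
  note P = lattice_filter_char_filter[OF p] scott_open_char_filter[OF p]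
  have H: "scott_open A (?D \<union> ?B)"
    by (intro scott_open_Un scott_open_dia[OF p] scott_open_join[OF P(2) a(1)])
  have dia: "e \<in> ?D \<union> ?B" if "e \<in> carrier A" "p (\<diamond>e)" for e
    using that by simp
  have stable: "e \<sqinter> d \<in> ?D \<union> ?B" if e: "e \<in> ?D \<union> ?B" and d: "d \<in> char_filter A p" for e d
  proof -
    have dA: "d \<in> carrier A"
      using d by (simp add: mem_char_filter)
    have ad: "a \<squnion> d \<in> char_filter A p"
      using lattice_filter_up[OF P(1) d join_right[of a d]] a dA by simp
    from e show ?thesis
    proof
      assume "e \<in> ?D"
      then show ?thesis
        using character_dia_char_filter[OF p _ d, of e] dA by simp
    next
      assume "e \<in> ?B"
      then have "a \<squnion> (e \<sqinter> d) \<in> char_filter A p" "e \<in> carrier A"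
        using lattice_filter_meet[OF P(1) _ ad, of "a \<squnion> e"] a dA by (simp_all add: join_meet_distrib)
      then show ?thesis
        using dA by simp
    qed
  qed
  \<comment> \<open>The extension starts at \<bottom>, which is outside both parts of
    \<open>H\<close> because \<open>p (\<diamond>\<bottom>)\<close> and \<open>p (\<box>a)\<close>
    fail.\<close>
  have "a \<squnion> \<bottom> = a"
    using le_iff_meet[of \<bottom> a] a join_comm[of A a \<bottom>] by simp
  then have "\<bottom> \<notin> ?D \<union> ?B"
    using character_dia_bottom[OF p] a by (simp add: mem_char_filter)
  then obtain x where x: "\<bottom> \<sqsubseteq> x" "x \<in> carrier A" "x \<notin> ?D \<union> ?B"
    and sat: "(p, x, {e \<in> carrier A. x \<squnion> e \<in> char_filter A p}) \<in> saturated A"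
    using saturated_extension[OF p H dia stable bottom_closed] by blast
  show thesis
  proof (rule that[OF sat])
    show "a \<notin> {e \<in> carrier A. x \<squnion> e \<in> char_filter A p}"
      using x join_comm[of A x a] by simp
  qed
qed

lemma character_saturated:
  assumes p: "frame_character A p"
  obtains x F where "(p, x, F) \<in> saturated A"
  using saturated_above[OF p bottom_closed character_dia_bottom[OF p]] by blast

text \<open>The meet condition of saturation is exactly what is needed to extend \<open>F\<close> by
  \<open>c\<close> without capturing \<open>x\<close>.\<close>

lemma saturated_D:
  assumes sat: "(p, x, F) \<in> saturated A" and c: "c \<in> carrier A" "\<not> c \<sqsubseteq> x"
  obtains q where "frame_character A q" "F \<subseteq> char_nabla A q" "\<not> q x" "q c"
proof -
  note pre = pre_points_RelSpqD[OF saturatedD(1)[OF sat]]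
  show thesis
  proof (rule character_extending_filter[OF pre(3) saturatedD(2)[OF sat] c(1) pre(2) _ c(2)])
    show "k \<sqsubseteq> x" if "k \<in> carrier A" "d \<in> F" "k \<sqinter> d \<sqsubseteq> x" for k d
      using that by (rule saturatedD(3)[OF sat])
  qed (rule that)
qed

text \<open>By the join condition of saturation, \<open>x \<squnion> c\<close> is outside
  \<open>F\<close>; a character that omits this join omits both \<open>x\<close> and
  \<open>c\<close>.\<close>

lemma saturated_B:
  assumes sat: "(p, x, F) \<in> saturated A" and c: "c \<in> carrier A" "c \<notin> F"
  obtains q where "frame_character A q" "F \<subseteq> char_nabla A q" "\<not> q x" "\<not> q c"
proof -
  note pre = pre_points_RelSpqD[OF saturatedD(1)[OF sat]]
  have "x \<squnion> c \<notin> F"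
    using saturatedD(4)[OF sat c(1)] c(2) by (rule contrapos_nn[rotated])
  then obtain q where "frame_character A q" "F \<subseteq> char_nabla A q" "\<not> q (x \<squnion> c)"
    using scott_open_filter_separation[OF pre(3) saturatedD(2)[OF sat]] pre(2) c(1) join_closed
    by metis
  then show thesis
    using that pre(2) c(1) by (simp add: character_join)
qed

text \<open>\<open>point_rel3\<close> restricts a successor only through its character
  \<open>q\<close>, so any triple of \<open>P\<close> over \<open>q\<close> will do. The set
  \<open>P\<close> is left open to cover both all saturated triples and the convex
  pre-points.\<close>

lemma point_D3_saturated:
  assumes P: "P \<subseteq> saturated A"
    and ex: "\<And>q. frame_character A q \<Longrightarrow> \<exists>y G. (q, y, G) \<in> P"
  shows "point_D3 A P"
  unfolding point_D3_def
proof (clarify, goal_cases)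
  case (1 p x F c)
  obtain q where q: "frame_character A q" "F \<subseteq> char_nabla A q" "\<not> q x" "q c"
    by (rule saturated_D[OF subsetD[OF P 1(1)] 1(2,3)])
  obtain y G where "(q, y, G) \<in> P"
    using ex[OF q(1)] by (elim exE)
  then show ?case
    using q by (intro bexI[of _ "(q, y, G)"]) (simp_all add: mem_point_rel3)
qed

lemma point_B3_saturated:
  assumes P: "P \<subseteq> saturated A"
    and ex: "\<And>q. frame_character A q \<Longrightarrow> \<exists>y G. (q, y, G) \<in> P"
  shows "point_B3 A P"
  unfolding point_B3_def
proof (clarify, goal_cases)
  case (1 p x F c)
  obtain q where q: "frame_character A q" "F \<subseteq> char_nabla A q" "\<not> q x" "\<not> q c"
    by (rule saturated_B[OF subsetD[OF P 1(1)] 1(2,3)])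
  obtain y G where "(q, y, G) \<in> P"
    using ex[OF q(1)] by (elim exE)
  then show ?case
    using q by (intro bexI[of _ "(q, y, G)"]) (simp_all add: mem_point_rel3)
qed


section \<open>The four versions of the point construction\<close>

text \<open>The argument common to both triple versions. A point over \<open>p\<close> whose filter
  omits \<open>a\<close> yields the witness for \<open>\<box>\<close> through (B); a point whose
  second component lies above \<open>a\<close> has no successor in \<open>a\<close> and is the
  witness for \<open>\<diamond>\<close>.\<close>

lemma triple_representation:
  assumes P: "P \<subseteq> pre_points_RelSpq A" and D: "point_D3 A P" and B: "point_B3 A P"
    and avoiding: "\<And>p a. \<lbrakk>frame_character A p; a \<in> carrier A; \<not> p (\<box>a)\<rbrakk> \<Longrightarrow>
      \<exists>x F. (p, x, F) \<in> P \<and> a \<notin> F"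
    and above: "\<And>p a. \<lbrakk>frame_character A p; a \<in> carrier A; \<not> p (\<diamond>a)\<rbrakk> \<Longrightarrow>
      \<exists>x F. (p, x, F) \<in> P \<and> a \<sqsubseteq> x"
  shows "modal_representation A P (point_rel3 A)"
proof (unfold_locales, goal_cases)
  case (1 z)
  obtain p x F where z: "z = (p, x, F)"
    by (cases z)
  show ?case
    using pre_points_RelSpqD(1)[OF subsetD[OF P 1[unfolded z]]] by (simp add: z)
next
  case (2 a b)
  obtain p where p: "frame_character A p" "p a" "\<not> p b"
    by (rule character_separation[OF 2])
  \<comment> \<open>At \<bottom>, \<open>above\<close> says that some point lies over
    \<open>p\<close>.\<close>
  obtain x F where "(p, x, F) \<in> P"
    using above[OF p(1) bottom_closed character_dia_bottom[OF p(1)]] by (elim exE conjE)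
  then show ?case
    using p by (intro bexI[of _ "(p, x, F)"]) simp_all
next
  case (3 z z' a)
  obtain p x F q y G where z: "z = (p, x, F)" "z' = (q, y, G)"
    by (cases z, cases z')
  have "a \<in> F"
    using 3 pre_points_RelSpqD(5)[OF subsetD[OF P]] by (auto simp: z mem_char_filter subset_iff)
  then show ?case
    using 3(3) by (auto simp: z mem_point_rel3 char_nabla_def)
next
  case (4 a b)
  obtain p where p: "frame_character A p" "p b" "\<not> p (\<box>a)"
    by (rule character_separation[OF 4(2) box_closed[OF 4(1)] 4(3)])
  obtain x F where x: "(p, x, F) \<in> P" "a \<notin> F"
    using avoiding[OF p(1) 4(1) p(3)] by (elim exE conjE)
  obtain q y G where "(q, y, G) \<in> P" "((p, x, F), (q, y, G)) \<in> point_rel3 A" "\<not> q a"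
    by (rule point_B3E[OF B x(1) 4(1) x(2)])
  then show ?case
    using p(2) x(1) by (intro bexI[of _ "(p, x, F)"] conjI bexI[of _ "(q, y, G)"]) simp_all
next
  case (5 z a)
  obtain p x F where z: "z = (p, x, F)"
    by (cases z)
  note pre = pre_points_RelSpqD[OF subsetD[OF P 5(1)[unfolded z]]]
  \<comment> \<open>If \<open>a \<sqsubseteq> x\<close>, then \<open>p (\<diamond>x)\<close> by
    monotonicity, contrary to (i). Hence (D) applies to \<open>a\<close>.\<close>
  have a: "\<not> a \<sqsubseteq> x"
    using character_dia_mono[OF pre(1) _ _ 5(2) pre(2)] pre(4) 5(3) by (auto simp: z)
  obtain q y G where "(q, y, G) \<in> P" "((p, x, F), (q, y, G)) \<in> point_rel3 A" "q a"
    by (rule point_D3E[OF D 5(1)[unfolded z] 5(2) a])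
  then show ?case
    by (intro bexI[of _ "(q, y, G)"]) (simp_all add: z)
next
  case (6 a b)
  obtain p where p: "frame_character A p" "p b" "\<not> p (\<diamond>a)"
    by (rule character_separation[OF 6(2) dia_closed[OF 6(1)] 6(3)])
  obtain x F where x: "(p, x, F) \<in> P" "a \<sqsubseteq> x"
    using above[OF p(1) 6(1) p(3)] by (elim exE conjE)
  note pre = pre_points_RelSpqD[OF subsetD[OF P x(1)]]
  have "\<not> fst w a" if w: "w \<in> P" "((p, x, F), w) \<in> point_rel3 A" for w
  proof -
    obtain q y G where w': "w = (q, y, G)"
      by (cases w)
    have "frame_character A q"
      using pre_points_RelSpqD(1) subsetD[OF P w(1)] unfolding w' .
    then show ?thesis
      using character_mono[OF _ 6(1) pre(2) x(2), of q] w(2) by (auto simp: w' mem_point_rel3)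
  qed
  then show ?case
    using p(2) x(1) by (intro bexI[of _ "(p, x, F)"]) simp_all
qed

text \<open>Coinduction: successors over any character can be chosen saturated, so the saturated
  triples satisfy (D) and (B) among themselves.\<close>

lemma saturated_subset_points_RelSpq: "saturated A \<subseteq> points_RelSpq A"
proof (rule points_RelSpq_upper)
  show "saturated A \<subseteq> pre_points_RelSpq A"
    by (auto simp: saturated_def)
  have "\<exists>y G. (q, y, G) \<in> saturated A" if q: "frame_character A q" for q
    by (rule character_saturated[OF q]) (intro exI)
  then show "point_D3 A (saturated A)" "point_B3 A (saturated A)"
    by (intro point_D3_saturated point_B3_saturated subset_refl; simp)+
qed

lemma modal_representation_RelSpq: "modal_representation A (points_RelSpq A) (point_rel3 A)"
proof (rule triple_representation[OF points_RelSpq_subset points_RelSpq_D points_RelSpq_B])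
  fix p a assume p: "frame_character A p" and a: "a \<in> carrier A"
  show "\<exists>x F. (p, x, F) \<in> points_RelSpq A \<and> a \<notin> F" if na: "\<not> p (\<box>a)"
  proof (rule saturated_avoiding[OF p a na])
    fix x F assume "(p, x, F) \<in> saturated A" "a \<notin> F"
    then show ?thesis
      using subsetD[OF saturated_subset_points_RelSpq] by (intro exI conjI)
  qed
  show "\<exists>x F. (p, x, F) \<in> points_RelSpq A \<and> a \<sqsubseteq> x" if na: "\<not> p (\<diamond>a)"
  proof (rule saturated_above[OF p a na])
    fix x F assume "(p, x, F) \<in> saturated A" "a \<sqsubseteq> x"
    then show ?thesis
      using subsetD[OF saturated_subset_points_RelSpq] by (intro exI conjI)
  qed
qed

text \<open>The relation on pairs is the one on triples with \<open>char_filter A p\<close> as the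
  filter.\<close>

lemma mem_point_rel2:
  "((p, x), (q, y)) \<in> point_rel2 A \<longleftrightarrow> \<not> q x \<and> char_filter A p \<subseteq> char_nabla A q"
  by (auto simp: point_rel2_def char_filter_def char_nabla_def le_bool_def)

text \<open>Coinduction with the filters forgotten. As \<open>F\<close> contains
  \<open>char_filter A p\<close>, every successor of the triple is a successor of the pair.\<close>

lemma saturated_points_RelSp:
  assumes "(p, x, F) \<in> saturated A"
  shows "(p, x) \<in> points_RelSp A"
proof -
  define Q where "Q = {(p, x). \<exists>F. (p, x, F) \<in> saturated A}"
  have "Q \<subseteq> points_RelSp A"
  proof (rule points_RelSp_upper)
    show "Q \<subseteq> pre_points_RelSp A"
      by (auto simp: Q_def pre_points_RelSp_def dest!: saturatedD(1) dest: pre_points_RelSpqD)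
    show "point_D2 A Q"
      unfolding point_D2_def
    proof (clarify, goal_cases)
      case (1 p x c)
      then obtain F where F: "(p, x, F) \<in> saturated A"
        unfolding Q_def by auto
      obtain q where q: "frame_character A q" "F \<subseteq> char_nabla A q" "\<not> q x" "q c"
        by (rule saturated_D[OF F 1(2,3)])
      obtain y G where "(q, y, G) \<in> saturated A"
        by (rule character_saturated[OF q(1)])
      then have "(q, y) \<in> Q"
        unfolding Q_def by auto
      moreover have "char_filter A p \<subseteq> char_nabla A q"
        using pre_points_RelSpqD(5)[OF saturatedD(1)[OF F]] q(2) by (rule subset_trans)
      ultimately show ?case
        using q by (intro bexI[of _ "(q, y)"]) (simp_all add: mem_point_rel2)
    qed
  qed
  moreover have "(p, x) \<in> Q"
    using assms unfolding Q_def by auto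
  ultimately show ?thesis by (rule subsetD)
qed

lemma modal_representation_RelSp: "modal_representation A (points_RelSp A) (point_rel2 A)"
proof (unfold_locales, goal_cases)
  case (1 z)
  then show ?case
    by (rule frame_character_points(1))
next
  case (2 a b)
  obtain p where p: "frame_character A p" "p a" "\<not> p b"
    by (rule character_separation[OF 2])
  obtain x F where "(p, x, F) \<in> saturated A"
    by (rule character_saturated[OF p(1)])
  then show ?case
    using p by (intro bexI[OF _ saturated_points_RelSp]) simp_all
next
  case (3 z z' a)
  obtain p x q y where z: "z = (p, x)" "z' = (q, y)"
    by (cases z, cases z')
  have "a \<in> char_filter A p"
    using 3 by (simp add: z mem_char_filter)
  then show ?case
    using 3(3) by (auto simp: z mem_point_rel2 char_nabla_def)
next
  case (4 a b)
  obtain p where p: "frame_character A p" "p b" "\<not> p (\<box>a)"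
    by (rule character_separation[OF 4(2) box_closed[OF 4(1)] 4(3)])
  obtain x F where x: "(p, x, F) \<in> saturated A" "a \<notin> F"
    by (rule saturated_avoiding[OF p(1) 4(1) p(3)])
  \<comment> \<open>Pairs carry no clause (B), so the successor omitting \<open>a\<close> is found
    at a saturated triple over \<open>p\<close>, whose filter is then forgotten.\<close>
  obtain q where q: "frame_character A q" "F \<subseteq> char_nabla A q" "\<not> q x" "\<not> q a"
    by (rule saturated_B[OF x(1) 4(1) x(2)])
  obtain y G where y: "(q, y, G) \<in> saturated A"
    by (rule character_saturated[OF q(1)])
  have "char_filter A p \<subseteq> char_nabla A q"
    using pre_points_RelSpqD(5)[OF saturatedD(1)[OF x(1)]] q(2) by (rule subset_trans)
  then show ?case
    using p(2) q
    by (intro bexI[OF _ saturated_points_RelSp[OF x(1)]] conjI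
        bexI[OF _ saturated_points_RelSp[OF y]]) (simp_all add: mem_point_rel2)
next
  case (5 z a)
  obtain p x where z: "z = (p, x)"
    by (cases z)
  have pre: "frame_character A p" "x \<in> carrier A" "\<not> p (\<diamond>x)"
    using subsetD[OF points_RelSp_subset 5(1)] by (simp_all add: z pre_points_RelSp_def)
  have a: "\<not> a \<sqsubseteq> x"
    using character_dia_mono[OF pre(1) _ _ 5(2) pre(2)] pre(3) 5(3) by (auto simp: z)
  obtain q y where "(q, y) \<in> points_RelSp A" "((p, x), (q, y)) \<in> point_rel2 A" "q a"
    by (rule point_D2E[OF points_RelSp_D 5(1)[unfolded z] 5(2) a])
  then show ?case
    by (intro bexI[of _ "(q, y)"]) (simp_all add: z)
next
  case (6 a b)
  obtain p where p: "frame_character A p" "p b" "\<not> p (\<diamond>a)"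
    by (rule character_separation[OF 6(2) dia_closed[OF 6(1)] 6(3)])
  obtain x F where x: "(p, x, F) \<in> saturated A" "a \<sqsubseteq> x"
    by (rule saturated_above[OF p(1) 6(1) p(3)])
  note pre = pre_points_RelSpqD[OF saturatedD(1)[OF x(1)]]
  have "\<not> fst w a" if w: "w \<in> points_RelSp A" "((p, x), w) \<in> point_rel2 A" for w
    using character_mono[OF frame_character_points(1)[OF w(1)] 6(1) pre(2) x(2)] w(2)
    by (cases w) (auto simp: mem_point_rel2)
  then show ?case
    using p(2) by (intro bexI[OF _ saturated_points_RelSp[OF x(1)]]) simp_all
qed

text \<open>In the convex case \<open>\<diamond>\<close> preserves all joins, so there is a largest \<open>x\<close> with \<open>p(\<diamond>x) = 0\<close>, and
  every pre-point is saturated.\<close>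

lemma pre_points_RelSpqcD:
  assumes "(p, x, F) \<in> pre_points_RelSpqc A"
  shows "(p, x, F) \<in> pre_points_RelSpq A" "F = char_filter A p"
    "\<lbrakk>c \<in> carrier A; \<not> p (\<diamond>c)\<rbrakk> \<Longrightarrow> c \<sqsubseteq> x"
  using assms by (auto simp: pre_points_RelSpqc_def pre_points_RelSpq_def)

text \<open>If \<open>p (\<diamond>c)\<close> and \<open>d\<close> is in
  \<open>char_filter A p\<close>, then \<open>p (\<diamond>(c \<sqinter> d))\<close>, so
  \<open>c \<sqinter> d\<close> is not below \<open>x\<close>; as \<open>x\<close> is above all
  \<open>c\<close> where \<open>p (\<diamond>c)\<close> fails, the meet condition follows. For the
  join condition, \<open>\<box>(c \<squnion> x) \<sqsubseteq> \<box>c \<squnion> \<diamond>x\<close>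
  and \<open>p (\<diamond>x)\<close> fails.\<close>

lemma pre_points_RelSpqc_saturated:
  assumes "convex_modal_frame A"
  shows "pre_points_RelSpqc A \<subseteq> saturated A"
proof (clarify)
  interpret C: convex_modal_frame A by fact
  fix p x F assume pt: "(p, x, F) \<in> pre_points_RelSpqc A"
  note pre = pre_points_RelSpqD[OF pre_points_RelSpqcD(1)[OF pt]]
  note F = pre_points_RelSpqcD(2)[OF pt]
  show "(p, x, F) \<in> saturated A"
  proof (rule saturatedI[OF pre_points_RelSpqcD(1)[OF pt]])
    show "scott_open A F"
      unfolding F by (rule scott_open_char_filter[OF pre(1)])
    fix c d assume c: "c \<in> carrier A" and d: "d \<in> F" and le: "c \<sqinter> d \<sqsubseteq> x"
    show "c \<sqsubseteq> x"
    proof (rule pre_points_RelSpqcD(3)[OF pt c], rule notI)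
      assume "p (\<diamond>c)"
      then have "p (\<diamond>(c \<sqinter> d))"
        using d c by (intro character_dia_char_filter[OF pre(1)]) (simp_all add: F)
      then have "p (\<diamond>x)"
        using lattice_filter_carrier[OF pre(3) d] c
        by (intro character_dia_mono[OF pre(1) _ le _ pre(2)]) simp_all
      with pre(4) show False ..
    qed
  next
    fix c assume c: "c \<in> carrier A" and xc: "x \<squnion> c \<in> F"
    have "p (\<box>(c \<squnion> x))"
      using xc join_comm[of A x c] by (simp add: F mem_char_filter)
    then have "p (\<box>c \<squnion> \<diamond>x)"
      using c pre(2)
      by (intro character_mono[OF pre(1) _ _ C.mbox_join[OF c pre(2)]])
        (simp_all add: box_closed dia_closed)
    then show "c \<in> F"
      using pre(4) c pre(2)
      by (simp add: F mem_char_filter character_join[OF pre(1)] box_closed dia_closed)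
  qed
qed

text \<open>By convexity the elements whose \<open>\<diamond>\<close> is sent to 0 are closed under
  binary joins, hence directed. Since \<open>\<diamond>\<close> preserves directed joins, their join
  is again such an element and is the required \<open>x\<close>.\<close>

lemma character_pre_points_RelSpqc:
  assumes "convex_modal_frame A" and p: "frame_character A p"
  obtains x where "(p, x, char_filter A p) \<in> pre_points_RelSpqc A"
proof -
  interpret C: convex_modal_frame A by fact
  define S where "S = {c \<in> carrier A. \<not> p (\<diamond>c)}"
  have SA: "S \<subseteq> carrier A"
    by (auto simp: S_def)
  have join: "c \<squnion> d \<in> S" if "c \<in> S" "d \<in> S" for c d
  proof -
    have cd: "c \<in> carrier A" "d \<in> carrier A" "\<not> p (\<diamond>c)" "\<not> p (\<diamond>d)"
      using that by (simp_all add: S_def)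
    have "\<not> p (\<diamond>(c \<squnion> d))"
      using character_mono[OF p _ _ C.mdia_join[OF cd(1,2)]] cd
      by (auto simp: character_join[OF p] dia_closed)
    then show ?thesis
      using cd by (simp add: S_def)
  qed
  have "\<exists>z\<in>S. c \<sqsubseteq> z \<and> d \<sqsubseteq> z" if "c \<in> S" "d \<in> S" for c d
    using join[OF that] that SA
    by (intro bexI[of _ "c \<squnion> d"]) (simp_all add: join_left join_right subset_iff)
  moreover have "\<bottom> \<in> S"
    using character_dia_bottom[OF p] by (simp add: S_def)
  ultimately have dir: "directed A S"
    unfolding directed_def using SA by blast
  have "\<not> p (\<diamond>(\<Squnion>S))"
    using character_dia_directed[OF p dir] by (auto simp: S_def)
  moreover have "c \<sqsubseteq> \<Squnion>S" if "c \<in> carrier A" "\<not> p (\<diamond>c)" for c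
    using that by (intro sup_upper[OF SA]) (simp add: S_def)
  ultimately have "(p, \<Squnion>S, char_filter A p) \<in> pre_points_RelSpqc A"
    using p SA lattice_filter_char_filter[OF p] by (simp add: pre_points_RelSpqc_def)
  then show thesis by (rule that)
qed

text \<open>Pre-points are saturated and exist over every character, so all of them together satisfy
  (D) and (B).\<close>

lemma points_RelSpqc_eq:
  assumes "convex_modal_frame A"
  shows "points_RelSpqc A = pre_points_RelSpqc A"
proof (rule equalityI[OF points_RelSpqc_subset points_RelSpqc_upper])
  have "\<exists>y G. (q, y, G) \<in> pre_points_RelSpqc A" if "frame_character A q" for q
    by (rule character_pre_points_RelSpqc[OF assms that]) (intro exI)
  then show "point_D3 A (pre_points_RelSpqc A)" "point_B3 A (pre_points_RelSpqc A)"
    by (intro point_D3_saturated point_B3_saturated pre_points_RelSpqc_saturated[OF assms]; simp)+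
qed simp

text \<open>One point over \<open>p\<close> serves both purposes: its filter is
  \<open>char_filter A p\<close>, and its second component is above every \<open>a\<close> for which
  \<open>p (\<diamond>a)\<close> fails.\<close>

lemma modal_representation_RelSpqc:
  assumes "convex_modal_frame A"
  shows "modal_representation A (points_RelSpqc A) (point_rel3 A)"
proof (rule triple_representation[OF _ points_RelSpqc_D points_RelSpqc_B])
  show "points_RelSpqc A \<subseteq> pre_points_RelSpq A"
    using points_RelSpqc_subset pre_points_RelSpqcD(1) by fast
  fix p a assume p: "frame_character A p" and a: "a \<in> carrier A"
  obtain x where x: "(p, x, char_filter A p) \<in> points_RelSpqc A"
    unfolding points_RelSpqc_eq[OF assms] by (rule character_pre_points_RelSpqc[OF assms p])
  show "\<exists>x F. (p, x, F) \<in> points_RelSpqc A \<and> a \<notin> F" if "\<not> p (\<box>a)"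
    using x that by (intro exI[of _ x] exI[of _ "char_filter A p"]) (simp add: mem_char_filter)
  show "\<exists>x F. (p, x, F) \<in> points_RelSpqc A \<and> a \<sqsubseteq> x" if "\<not> p (\<diamond>a)"
    using x pre_points_RelSpqcD(3)[OF subsetD[OF points_RelSpqc_subset x] a that]
    by (intro exI conjI)
qed

end

theorem theorem3:
  fixes A :: "('a, 'm) modal_order_scheme"
  assumes "modally_spectral_frame A"
  shows "(modal_frame A \<longrightarrow> MFrm_iso A (Omega (F_RelSp A)) (phi_RelSp A)) \<and>
         (modal_frame A \<longrightarrow> MFrm_iso A (Omega (F_RelSpq A)) (phi_RelSpq A)) \<and>
         (convex_modal_frame A \<longrightarrow> CMFrm_iso A (Omega (F_RelSpqc A)) (phi_RelSpqc A)) \<and>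
         (convex_equivalence_frame A \<longrightarrow> CEqFrm_iso A (Omega (F_EqSpq A)) (phi_EqSpq A))"
proof (intro conjI impI)
  interpret modally_spectral_frame A by fact
  show "MFrm_iso A (Omega (F_RelSp A)) (phi_RelSp A)"
    unfolding F_RelSp_def phi_RelSp_def
    by (rule modal_representation.MFrm_iso_phi_on[OF modal_representation_RelSp])
  show "MFrm_iso A (Omega (F_RelSpq A)) (phi_RelSpq A)"
    unfolding F_RelSpq_def phi_RelSpq_def
    by (rule modal_representation.MFrm_iso_phi_on[OF modal_representation_RelSpq])
  show "CMFrm_iso A (Omega (F_RelSpqc A)) (phi_RelSpqc A)" if "convex_modal_frame A"
    unfolding F_RelSpqc_def phi_RelSpqc_def
    by (rule modal_representation.CMFrm_iso_phi_on[OF modal_representation_RelSpqc[OF that] that])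
  \<comment> \<open>Equivalence spaces have the same points as the convex case; the equivalence
    axioms pass to the frame of opens along the surjection.\<close>
  show "CEqFrm_iso A (Omega (F_EqSpq A)) (phi_EqSpq A)" if "convex_equivalence_frame A"
    unfolding F_EqSpq_def phi_EqSpq_def F_RelSpqc_def phi_RelSpqc_def
    using that
    by (intro modal_representation.CEqFrm_iso_phi_on[OF modal_representation_RelSpqc])
      (simp add: convex_equivalence_frame_def)
qed

end
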